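(* Assume that for every $\delta>0$ there exists a family of functions $(\varphi_x)_{x\in M}\subset\mathrm{UC}_\kappa$ satisfying the following: (i) for every $x\in M$: $0\le\varphi_x(y)\le1$ for all $y\in M$, $\varphi_x(x)=0$, and $\varphi_x(y)=1$ for all $y\in M$ with $d(x,y)\ge\delta$; (ii') there exist $L\ge0$ and $h_0>0$ such that, for all $h\in[0,h_0)$ and $x\in M$, $$\sup_{\lambda\in\Lambda}\|S_\lambda(h)\varphi_x-\varphi_x\|_\kappa\le Lh.$$ Then the semigroup envelope $\mathscr{S}$ is strongly continuous, i.e. $[0,\infty)\to\mathrm{UC}_\kappa$, $t\mapsto\mathscr{S}(t)u$ is continuous (w.r.t. $\|\cdot\|_\kappa$) for all $u\in\mathrm{UC}_\kappa$.
   Context: Setting: $\Lambda$ is a nonempty set, $(M,d)$ is a separable metric space, and $\kappa\colon M\to(0,\infty)$ is continuous and bounded. $\|u\|_\infty=\sup_{x\in M}|u(x)|$; $\|u\|_\kappa=\|\kappa u\|_\infty$; $\|u\|_{\mathrm{Lip}}=\inf\{L\ge 0: |u(x)-u(y)|\le L d(x,y)\ \forall x,y\in M\}$. $\mathrm{C}_\kappa$ is the space of continuous $u\colon M\to\mathbb{R}$ with $\|u\|_\kappa<\infty$; $\mathrm{Lip}_{\rm b}$ is the space of bounded Lipschitz functions $M\to\mathbb{R}$; $\mathrm{UC}_\kappa$ is the closure of $\mathrm{Lip}_{\rm b}$ in $(\mathrm{C}_\kappa,\|\cdot\|_\kappa)$. For $u_n,u\in\mathrm{UC}_\kappa$, $u_n\nearrow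 u$ means $u_n\le u_{n+1}$ for all $n$ and $u_n(x)\to u(x)$ for all $x\in M$. A Feller semigroup is a family $T=(T(t))_{t\ge0}$ of possibly nonlinear operators such that (i) $T(t)\colon\mathrm{UC}_\kappa\to\mathrm{UC}_\kappa$ is continuous for all $t\ge 0$; (ii) $T(0)u=u$ and $T(s+t)u=T(s)T(t)u$ for all $s,t\ge0$, $u\in\mathrm{UC}_\kappa$; (iii) each $T(t)$ is monotone and continuous from below, i.e. $u_n\nearrow u$ in $\mathrm{UC}_\kappa$ implies $T(t)u_n\nearrow T(t)u$. Standing assumptions: (A1) for every $\lambda\in\Lambda$, $S_\lambda=(S_\lambda(t))_{t\ge0}$ is a Feller semigroup of linear operators with $S_\lambda(t)1=1$ for all $t\geq 0$; (A2) there are $\alpha,\beta\in\mathbb{R}$ with $\|S_\lambda(t)u\|_\kappa\le e^{\alpha t}\|u\|_\kappa$ and $\|S_\lambda(t)u\|_{\mathrm{Lip}}\le e^{\beta t}\|u\|_{\mathrm{Lip}}$ for all $u\in\mathrm{Lip}_{\rm b}$, $\lambda\in\Lambda$, $t\ge0$. For $h\ge0$, $u\in\mathrm{UC}_\kappa$: $(\mathcal{E}_hu)(x)=\sup_{\lambda\in\Lambda}(S_\lambda(h)u)(x)$; $\mathcal{E}_h$ maps $\mathrm{UC}_\kappa$ to itself. $P$ is the set of finite subsets $\pi\subset[0,\infty)$ with $0\in\pi$, and $P_t=\{\pi\in P:\max\pi=t\}$. For $\pi=\{t_0,\dots,t_m\}$ with $0=t_0<t_1<\dots<t_m$, $m\ge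 1$, $\mathcal{E}_\pi u=\mathcal{E}_{t_1-t_0}\cdots\mathcal{E}_{t_m-t_{m-1}}u$ (composition), and $\mathcal{E}_{\{0\}}u=u$. The semigroup envelope $\mathscr{S}=(\mathscr{S}(t))_{t\ge0}$ is $(\mathscr{S}(t)u)(x)=\sup_{\pi\in P_t}(\mathcal{E}_\pi u)(x)$ for $t\ge0$, $u\in\mathrm{UC}_\kappa$, $x\in M$; it is a Feller semigroup. *)

theory Defs
  imports "HOL-Analysis.Analysis"
begin

text \<open>
  The metric space \<open>M\<close> is the carrier of a type of class \<open>metric_space\<close>.  Norms take values in
  \<^typ>\<open>ereal\<close>, so that a function of infinite norm really has norm \<open>\<infinity>\<close>; in particular
  \<open>lip_norm u = \<infinity>\<close> if \<open>u\<close> is not Lipschitz.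
\<close>

definition sup_norm :: "('a \<Rightarrow> real) \<Rightarrow> ereal" where
  "sup_norm u = (SUP x. ereal \<bar>u x\<bar>)"

definition kappa_norm :: "('a \<Rightarrow> real) \<Rightarrow> ('a \<Rightarrow> real) \<Rightarrow> ereal" where
  "kappa_norm \<kappa> u = sup_norm (\<lambda>x. \<kappa> x * u x)"

definition lip_norm :: "('a::metric_space \<Rightarrow> real) \<Rightarrow> ereal" where
  "lip_norm u = (INF L\<in>{L. L-lipschitz_on UNIV u}. ereal L)"

definition C_kappa :: "('a::metric_space \<Rightarrow> real) \<Rightarrow> ('a \<Rightarrow> real) set" where
  "C_kappa \<kappa> = {u. continuous_on UNIV u \<and> kappa_norm \<kappa> u < \<infinity>}"

definition Lip_b :: "('a::metric_space \<Rightarrow> real) set" where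
  "Lip_b = {u. bounded (range u) \<and> (\<exists>L. L-lipschitz_on UNIV u)}"

definition kappa_dist :: "('a \<Rightarrow> real) \<Rightarrow> ('a \<Rightarrow> real) \<Rightarrow> ('a \<Rightarrow> real) \<Rightarrow> real" where
  "kappa_dist \<kappa> u v = real_of_ereal (kappa_norm \<kappa> (\<lambda>x. u x - v x))"

lemma kappa_norm_nonneg: "0 \<le> kappa_norm \<kappa> u"
proof -
  have "0 \<le> ereal \<bar>\<kappa> undefined * u undefined\<bar>" by simp
  also have "\<dots> \<le> kappa_norm \<kappa> u"
    unfolding kappa_norm_def sup_norm_def by (rule SUP_upper) simp
  finally show ?thesis .
qed

lemma kappa_norm_diff_triangle:
  "kappa_norm \<kappa> (\<lambda>x. u x - w x)
     \<le> kappa_norm \<kappa> (\<lambda>x. u x - v x) + kappa_norm \<kappa> (\<lambda>x. v x - w x)"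
  unfolding kappa_norm_def sup_norm_def
proof (rule SUP_least)
  fix x
  have "\<bar>\<kappa> x * (u x - w x)\<bar> \<le> \<bar>\<kappa> x * (u x - v x)\<bar> + \<bar>\<kappa> x * (v x - w x)\<bar>"
    using abs_triangle_ineq[of "\<kappa> x * (u x - v x)" "\<kappa> x * (v x - w x)"]
    by (simp add: algebra_simps)
  then have "ereal \<bar>\<kappa> x * (u x - w x)\<bar>
      \<le> ereal \<bar>\<kappa> x * (u x - v x)\<bar> + ereal \<bar>\<kappa> x * (v x - w x)\<bar>"
    by simp
  also have "\<dots> \<le> (SUP x. ereal \<bar>\<kappa> x * (u x - v x)\<bar>) + (SUP x. ereal \<bar>\<kappa> x * (v x - w x)\<bar>)"
    by (intro add_mono SUP_upper) simp_all
  finally show "ereal \<bar>\<kappa> x * (u x - w x)\<bar> \<le> \<dots>" .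
qed

lemma kappa_norm_minus_commute:
  "kappa_norm \<kappa> (\<lambda>x. u x - v x) = kappa_norm \<kappa> (\<lambda>x. v x - u x)"
  by (simp add: kappa_norm_def sup_norm_def abs_mult abs_minus_commute)

lemma kappa_norm_diff_finite:
  assumes "u \<in> C_kappa \<kappa>" "v \<in> C_kappa \<kappa>"
  shows "\<bar>kappa_norm \<kappa> (\<lambda>x. u x - v x)\<bar> \<noteq> \<infinity>"
proof -
  have "kappa_norm \<kappa> (\<lambda>x. u x - v x)
      \<le> kappa_norm \<kappa> (\<lambda>x. u x - 0) + kappa_norm \<kappa> (\<lambda>x. 0 - v x)"
    by (rule kappa_norm_diff_triangle)
  also have "\<dots> = kappa_norm \<kappa> u + kappa_norm \<kappa> v"
    using kappa_norm_minus_commute[of \<kappa> "\<lambda>_. 0" v] by simp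
  also have "\<dots> < \<infinity>" using assms by (auto simp: C_kappa_def)
  finally show ?thesis using kappa_norm_nonneg[of \<kappa> "\<lambda>x. u x - v x"] by auto
qed

lemma Metric_space_C_kappa:
  assumes pos: "\<And>x. 0 < \<kappa> x"
  shows "Metric_space (C_kappa \<kappa>) (kappa_dist \<kappa>)"
proof
  show "0 \<le> kappa_dist \<kappa> u v" for u v
    by (simp add: kappa_dist_def real_of_ereal_pos kappa_norm_nonneg)
  show "kappa_dist \<kappa> u v = kappa_dist \<kappa> v u" for u v
    unfolding kappa_dist_def by (subst kappa_norm_minus_commute) simp
  show "kappa_dist \<kappa> u v = 0 \<longleftrightarrow> u = v" if "u \<in> C_kappa \<kappa>" "v \<in> C_kappa \<kappa>" for u v
  proof
    assume "kappa_dist \<kappa> u v = 0"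
    then have z: "kappa_norm \<kappa> (\<lambda>x. u x - v x) = 0"
      using kappa_norm_diff_finite[OF that] by (auto simp: kappa_dist_def real_of_ereal_eq_0)
    show "u = v"
    proof
      fix x
      have "ereal \<bar>\<kappa> x * (u x - v x)\<bar> \<le> kappa_norm \<kappa> (\<lambda>x. u x - v x)"
        unfolding kappa_norm_def sup_norm_def by (rule SUP_upper) simp
      then show "u x = v x" using z pos[of x] by simp
    qed
  qed (simp add: kappa_dist_def kappa_norm_def sup_norm_def)
  show "kappa_dist \<kappa> u w \<le> kappa_dist \<kappa> u v + kappa_dist \<kappa> v w"
    if uvw: "u \<in> C_kappa \<kappa>" "v \<in> C_kappa \<kappa>" "w \<in> C_kappa \<kappa>" for u v w
  proof -
    obtain a where a: "kappa_norm \<kappa> (\<lambda>x. u x - w x) = ereal a"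
      using kappa_norm_diff_finite[OF uvw(1,3)] by (metis ereal_real')
    obtain b where b: "kappa_norm \<kappa> (\<lambda>x. u x - v x) = ereal b"
      using kappa_norm_diff_finite[OF uvw(1,2)] by (metis ereal_real')
    obtain c where c: "kappa_norm \<kappa> (\<lambda>x. v x - w x) = ereal c"
      using kappa_norm_diff_finite[OF uvw(2,3)] by (metis ereal_real')
    show ?thesis
      using kappa_norm_diff_triangle[of \<kappa> u w v] a b c by (simp add: kappa_dist_def)
  qed
qed

definition UC_kappa :: "('a::metric_space \<Rightarrow> real) \<Rightarrow> ('a \<Rightarrow> real) set" where
  "UC_kappa \<kappa> = Metric_space.mtopology (C_kappa \<kappa>) (kappa_dist \<kappa>) closure_of Lip_b"

definition UC_topology :: "('a::metric_space \<Rightarrow> real) \<Rightarrow> ('a \<Rightarrow> real) topology" where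
  "UC_topology \<kappa> = Metric_space.mtopology (UC_kappa \<kappa>) (kappa_dist \<kappa>)"

lemma topspace_UC_topology:
  assumes "\<And>x. 0 < \<kappa> x"
  shows "topspace (UC_topology \<kappa>) = UC_kappa \<kappa>"
proof -
  interpret C: Metric_space "C_kappa \<kappa>" "kappa_dist \<kappa>"
    using assms by (rule Metric_space_C_kappa)
  have "UC_kappa \<kappa> \<subseteq> C_kappa \<kappa>"
    unfolding UC_kappa_def by (rule order_trans[OF closure_of_subset_topspace]) simp
  then interpret U: Metric_space "UC_kappa \<kappa>" "kappa_dist \<kappa>"
    by (rule C.subspace)
  show ?thesis by (simp add: UC_topology_def)
qed

definition increases_to :: "(nat \<Rightarrow> 'a \<Rightarrow> real) \<Rightarrow> ('a \<Rightarrow> real) \<Rightarrow> bool" where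
  "increases_to us u \<longleftrightarrow>
     (\<forall>n x. us n x \<le> us (Suc n) x) \<and> (\<forall>x. (\<lambda>n. us n x) \<longlonglongrightarrow> u x)"

text \<open>
  Operators on \<open>UC_kappa \<kappa>\<close> are represented by total functions whose values outside
  \<open>UC_kappa \<kappa>\<close>, and at negative times, are irrelevant.  That \<open>T t\<close> maps \<open>UC_kappa \<kappa>\<close>
  into itself is part of \<open>continuous_map\<close>.
\<close>

definition feller_semigroup ::
    "('a::metric_space \<Rightarrow> real) \<Rightarrow> (real \<Rightarrow> ('a \<Rightarrow> real) \<Rightarrow> ('a \<Rightarrow> real)) \<Rightarrow> bool" where
  "feller_semigroup \<kappa> T \<longleftrightarrow>
     (\<forall>t\<ge>0. continuous_map (UC_topology \<kappa>) (UC_topology \<kappa>) (T t)) \<and>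
     (\<forall>u\<in>UC_kappa \<kappa>. T 0 u = u) \<and>
     (\<forall>s\<ge>0. \<forall>t\<ge>0. \<forall>u\<in>UC_kappa \<kappa>. T (s + t) u = T s (T t u)) \<and>
     (\<forall>t\<ge>0. \<forall>u\<in>UC_kappa \<kappa>. \<forall>v\<in>UC_kappa \<kappa>. (\<forall>x. u x \<le> v x) \<longrightarrow> (\<forall>x. T t u x \<le> T t v x)) \<and>
     (\<forall>t\<ge>0. \<forall>us u. (\<forall>n. us n \<in> UC_kappa \<kappa>) \<longrightarrow> u \<in> UC_kappa \<kappa> \<longrightarrow> increases_to us u \<longrightarrow>
        increases_to (\<lambda>n. T t (us n)) (T t u))"

definition linear_operators ::
    "('a::metric_space \<Rightarrow> real) \<Rightarrow> (real \<Rightarrow> ('a \<Rightarrow> real) \<Rightarrow> ('a \<Rightarrow> real)) \<Rightarrow> bool" where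
  "linear_operators \<kappa> T \<longleftrightarrow>
     (\<forall>t\<ge>0. \<forall>u\<in>UC_kappa \<kappa>. \<forall>v\<in>UC_kappa \<kappa>. \<forall>a b.
        T t (\<lambda>x. a * u x + b * v x) = (\<lambda>x. a * T t u x + b * T t v x))"

definition strongly_continuous ::
    "('a::metric_space \<Rightarrow> real) \<Rightarrow> (real \<Rightarrow> ('a \<Rightarrow> real) \<Rightarrow> ('a \<Rightarrow> real)) \<Rightarrow> bool" where
  "strongly_continuous \<kappa> T \<longleftrightarrow>
     (\<forall>u\<in>UC_kappa \<kappa>. continuous_map (top_of_set {0..}) (UC_topology \<kappa>) (\<lambda>t. T t u))"

text \<open>
  The suprema in \<open>upper_op\<close> and \<open>envelope\<close> are suprema of reals.  They are meaningful for
  \<open>u \<in> UC_kappa \<kappa>\<close> since the growth bounds on the \<open>S l\<close> make the families bounded at every point.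
\<close>

definition upper_op ::
    "'l set \<Rightarrow> ('l \<Rightarrow> real \<Rightarrow> ('a \<Rightarrow> real) \<Rightarrow> ('a \<Rightarrow> real)) \<Rightarrow> real \<Rightarrow> ('a \<Rightarrow> real) \<Rightarrow> ('a \<Rightarrow> real)" where
  "upper_op \<Lambda> S h u = (\<lambda>x. SUP l\<in>\<Lambda>. S l h u x)"

definition partitions :: "real \<Rightarrow> real set set" where
  "partitions t = {\<pi>. finite \<pi> \<and> \<pi> \<subseteq> {0..} \<and> 0 \<in> \<pi> \<and> Max \<pi> = t}"

fun upper_op_list ::
    "'l set \<Rightarrow> ('l \<Rightarrow> real \<Rightarrow> ('a \<Rightarrow> real) \<Rightarrow> ('a \<Rightarrow> real)) \<Rightarrow> real list \<Rightarrow> ('a \<Rightarrow> real) \<Rightarrow> ('a \<Rightarrow> real)" where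
  "upper_op_list \<Lambda> S (s # t # ts) u = upper_op \<Lambda> S (t - s) (upper_op_list \<Lambda> S (t # ts) u)"
| "upper_op_list \<Lambda> S [s] u = u"
| "upper_op_list \<Lambda> S [] u = u"

definition upper_op_partition ::
    "'l set \<Rightarrow> ('l \<Rightarrow> real \<Rightarrow> ('a \<Rightarrow> real) \<Rightarrow> ('a \<Rightarrow> real)) \<Rightarrow> real set \<Rightarrow> ('a \<Rightarrow> real) \<Rightarrow> ('a \<Rightarrow> real)" where
  "upper_op_partition \<Lambda> S \<pi> u = upper_op_list \<Lambda> S (sorted_list_of_set \<pi>) u"

definition envelope ::
    "'l set \<Rightarrow> ('l \<Rightarrow> real \<Rightarrow> ('a \<Rightarrow> real) \<Rightarrow> ('a \<Rightarrow> real)) \<Rightarrow> real \<Rightarrow> ('a \<Rightarrow> real) \<Rightarrow> ('a \<Rightarrow> real)" where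
  "envelope \<Lambda> S t u = (\<lambda>x. SUP \<pi>\<in>partitions t. upper_op_partition \<Lambda> S \<pi> u x)"

end

theory Submission
  imports Defs
begin

text \<open>
  The values of the envelope at two times \<open>s \<le> t\<close> are compared directly through partitions.  A
  partition of \<open>[0, t]\<close> can be refined to contain \<open>s\<close>, which only increases the associated operator;
  this operator is then the composition of one over \<open>[0, s]\<close> with one over \<open>[s, t]\<close>.
  Operators over \<open>[0, s]\<close> are Lipschitz in the weighted norm with constant \<open>exp (\<alpha> * s)\<close>, so the
  envelopes of \<open>u\<close> at \<open>s\<close> and \<open>t\<close> differ by at most \<open>exp (\<alpha> * s)\<close> times the largest
  increment of \<open>u\<close> under the operators over \<open>[s, t]\<close> (\<open>envelope_increment\<close>).  It remains to show
  that these increments vanish as \<open>t - s\<close> tends to \<open>0\<close>.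

  By density \<open>u\<close> may be taken bounded and Lipschitz (\<open>increments_vanish_UC\<close>).  Near a point
  \<open>x\<close> such a function is caught between two affine functions of the cut-off \<open>\<phi> x\<close>, with an
  error that is small with \<open>\<delta>\<close>.  The hypothesis says that one step of any of the linear semigroups
  changes \<open>\<phi> x\<close> by at most \<open>L\<close> times its length, uniformly in \<open>x\<close>; summed along a partition
  (\<open>EL_increment\<close>), this gives a change of order \<open>t - s\<close> for the two bounding functions, and by
  monotonicity for \<open>u\<close> (\<open>increments_vanish_Lip_b\<close>).

  That all operators involved preserve the space, are monotone and obey the Lipschitz estimates is
  handled once and for all by the notion \<open>admissible\<close>, which is stable under composition and
  under suprema.
\<close>

section \<open>The weighted space\<close>

definition kappa_close :: "('a \<Rightarrow> real) \<Rightarrow> real \<Rightarrow> ('a \<Rightarrow> real) \<Rightarrow> ('a \<Rightarrow> real) \<Rightarrow> bool" where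
  "kappa_close \<kappa> c u v \<longleftrightarrow> (\<forall>x. \<kappa> x * \<bar>u x - v x\<bar> \<le> c)"

lemma kappa_close_mono: "kappa_close \<kappa> c u v \<Longrightarrow> c \<le> c' \<Longrightarrow> kappa_close \<kappa> c' u v"
  unfolding kappa_close_def by (meson order_trans)

lemma kappa_close_commute: "kappa_close \<kappa> c u v \<longleftrightarrow> kappa_close \<kappa> c v u"
  unfolding kappa_close_def by (simp add: abs_minus_commute)

text \<open>
  The infimum in \<open>lip_norm\<close> is attained: every Lipschitz constant dominates each difference
  quotient, hence so does their infimum.
\<close>

lemma lip_norm_le_imp_lipschitz:
  assumes "lip_norm u \<le> ereal K" "0 \<le> K"
  shows "K-lipschitz_on UNIV u"
proof (rule lipschitz_onI)
  fix x y
  show "dist (u x) (u y) \<le> K * dist x y"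
  proof (rule ccontr)
    assume less: "\<not> ?thesis"
    then have xy: "0 < dist x y" by auto
    have "ereal (dist (u x) (u y) / dist x y) \<le> lip_norm u"
      unfolding lip_norm_def
    proof (rule INF_greatest)
      fix L assume "L \<in> {L. L-lipschitz_on UNIV u}"
      then have "dist (u x) (u y) \<le> L * dist x y" by (auto dest: lipschitz_onD)
      then show "ereal (dist (u x) (u y) / dist x y) \<le> ereal L"
        using xy by (simp add: pos_divide_le_eq)
    qed
    then have "ereal (dist (u x) (u y) / dist x y) \<le> ereal K" using assms(1) by (rule order_trans)
    then show False using xy less by (simp add: pos_divide_le_eq)
  qed
qed (fact assms(2))

lemma lip_norm_le: "K-lipschitz_on UNIV u \<Longrightarrow> lip_norm u \<le> ereal K"
  unfolding lip_norm_def by (rule INF_lower) simp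

lemma Lip_bI:
  assumes "\<And>x. \<bar>u x\<bar> \<le> B" "K-lipschitz_on UNIV u"
  shows "u \<in> Lip_b"
  unfolding Lip_b_def bounded_iff using assms by auto

lemma Lip_bE:
  assumes "u \<in> Lip_b"
  obtains B K where "\<forall>x. \<bar>u x\<bar> \<le> B" "K-lipschitz_on UNIV u"
  using assms unfolding Lip_b_def bounded_iff by auto

lemma const_in_Lip_b: "(\<lambda>_. c) \<in> Lip_b"
  by (rule Lip_bI[of _ "\<bar>c\<bar>" 0]) (auto intro: lipschitz_onI)

locale weight =
  fixes \<kappa> :: "'a::metric_space \<Rightarrow> real"
  assumes pos: "0 < \<kappa> x"
    and cont: "continuous_on UNIV \<kappa>"
    and bdd: "bounded (range \<kappa>)"
begin

abbreviation close :: "real \<Rightarrow> ('a \<Rightarrow> real) \<Rightarrow> ('a \<Rightarrow> real) \<Rightarrow> bool" where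
  "close \<equiv> kappa_close \<kappa>"

abbreviation UC :: "('a \<Rightarrow> real) set" where
  "UC \<equiv> UC_kappa \<kappa>"

lemma closeD: "close c u v \<Longrightarrow> \<bar>u x - v x\<bar> \<le> c / \<kappa> x"
  using pos[of x] by (simp add: kappa_close_def pos_le_divide_eq mult.commute)

lemma closeI: "(\<And>x. \<bar>u x - v x\<bar> \<le> c / \<kappa> x) \<Longrightarrow> close c u v"
  unfolding kappa_close_def using pos by (simp add: pos_le_divide_eq mult.commute)

lemma close_trans:
  assumes "close c u v" "close c' v w"
  shows "close (c + c') u w"
proof (rule closeI)
  fix x
  show "\<bar>u x - w x\<bar> \<le> (c + c') / \<kappa> x"
    using closeD[OF assms(1), of x] closeD[OF assms(2), of x] by (simp add: add_divide_distrib)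
qed

lemma kappa_norm_le_iff: "kappa_norm \<kappa> (\<lambda>x. u x - v x) \<le> ereal c \<longleftrightarrow> close c u v"
  using pos by (simp add: kappa_norm_def sup_norm_def SUP_le_iff kappa_close_def abs_mult less_imp_le)

lemma kappa_norm_le_iff_0: "kappa_norm \<kappa> u \<le> ereal c \<longleftrightarrow> close c u (\<lambda>_. 0)"
  using kappa_norm_le_iff[of u "\<lambda>_. 0"] by simp

sublocale C: Metric_space "C_kappa \<kappa>" "kappa_dist \<kappa>"
  using pos by (rule Metric_space_C_kappa)

lemma kappa_dist_le_iff:
  assumes "u \<in> C_kappa \<kappa>" "v \<in> C_kappa \<kappa>"
  shows "kappa_dist \<kappa> u v \<le> c \<longleftrightarrow> close c u v"
proof -
  have "kappa_norm \<kappa> (\<lambda>x. u x - v x) = ereal (kappa_dist \<kappa> u v)"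
    unfolding kappa_dist_def using kappa_norm_diff_finite[OF assms] by (simp add: ereal_real')
  then show ?thesis using kappa_norm_le_iff[of u v c] by simp
qed

lemma C_kappaI:
  assumes "continuous_on UNIV u" "close c u (\<lambda>_. 0)"
  shows "u \<in> C_kappa \<kappa>"
proof -
  have "kappa_norm \<kappa> u \<le> ereal c" using assms(2) by (simp add: kappa_norm_le_iff_0)
  then have "kappa_norm \<kappa> u < \<infinity>" by (rule order_le_less_trans) simp
  then show ?thesis using assms(1) by (simp add: C_kappa_def)
qed

lemma C_kappaE:
  assumes "u \<in> C_kappa \<kappa>"
  obtains c where "close c u (\<lambda>_. 0)"
proof -
  have "kappa_norm \<kappa> u < \<infinity>" using assms by (simp add: C_kappa_def)
  then obtain c where "kappa_norm \<kappa> u = ereal c"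
    using kappa_norm_nonneg[of \<kappa> u] by (cases "kappa_norm \<kappa> u") auto
  then have "close c u (\<lambda>_. 0)" using kappa_norm_le_iff_0[of u c] by simp
  then show ?thesis by (rule that)
qed

lemma kappa_upper: obtains C where "0 < C" "\<forall>x. \<kappa> x \<le> C"
  using bdd pos unfolding bounded_pos by (auto simp: abs_le_iff)

lemma Lip_b_subset_C: "Lip_b \<subseteq> C_kappa \<kappa>"
proof
  fix u :: "'a \<Rightarrow> real" assume "u \<in> Lip_b"
  then obtain B K where u: "\<forall>x. \<bar>u x\<bar> \<le> B" "K-lipschitz_on UNIV u" by (rule Lip_bE)
  obtain C where C: "0 < C" "\<forall>x. \<kappa> x \<le> C" by (rule kappa_upper)
  have "close (C * B) u (\<lambda>_. 0)"
    unfolding kappa_close_def using u(1) C pos by (auto intro!: mult_mono simp: less_imp_le)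
  then show "u \<in> C_kappa \<kappa>" using lipschitz_on_continuous_on[OF u(2)] by (rule C_kappaI[rotated])
qed

text \<open>
  Continuity of a limit of bounded Lipschitz functions comes for free: after multiplication by
  \<open>\<kappa>\<close> the convergence is uniform, and one may divide by \<open>\<kappa>\<close> again because it is continuous
  without zeros.
\<close>

lemma UC_iff: "u \<in> UC \<longleftrightarrow> (\<forall>\<epsilon>>0. \<exists>v\<in>Lip_b. close \<epsilon> u v)"
proof
  assume u: "u \<in> UC"
  show "\<forall>\<epsilon>>0. \<exists>v\<in>Lip_b. close \<epsilon> u v"
  proof (intro allI impI)
    fix \<epsilon> :: real assume "0 < \<epsilon>"
    then obtain v where "v \<in> Lip_b" "v \<in> C.mball u \<epsilon>"
      using u unfolding UC_kappa_def C.metric_closure_of by blast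
    then show "\<exists>v\<in>Lip_b. close \<epsilon> u v"
      using kappa_dist_le_iff[of u v \<epsilon>] by (auto intro!: bexI[of _ v])
  qed
next
  assume approx: "\<forall>\<epsilon>>0. \<exists>v\<in>Lip_b. close \<epsilon> u v"
  have "\<exists>v. v \<in> Lip_b \<and> close (1 / real (Suc n)) u v" for n
    using approx[rule_format, of "1 / real (Suc n)"] by auto
  then obtain v where v: "\<And>n. v n \<in> Lip_b" "\<And>n. close (1 / real (Suc n)) u (v n)" by metis
  have "uniform_limit UNIV (\<lambda>n x. \<kappa> x * v n x) (\<lambda>x. \<kappa> x * u x) sequentially"
  proof (rule uniform_limitI)
    fix e :: real assume "0 < e"
    then have "\<forall>\<^sub>F n in sequentially. 1 / real (Suc n) < e"
      using LIMSEQ_inverse_real_of_nat by (auto simp: inverse_eq_divide dest: order_tendstoD(2))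
    then show "\<forall>\<^sub>F n in sequentially. \<forall>x\<in>UNIV. dist (\<kappa> x * v n x) (\<kappa> x * u x) < e"
    proof (eventually_elim, intro ballI)
      fix n x assume n: "1 / real (Suc n) < e"
      have "dist (\<kappa> x * v n x) (\<kappa> x * u x) = \<kappa> x * \<bar>u x - v n x\<bar>"
        using pos[of x]
        by (simp add: dist_real_def abs_minus_commute flip: right_diff_distrib abs_mult_pos'[of "\<kappa> x"])
      also have "\<dots> \<le> 1 / real (Suc n)" using v(2) unfolding kappa_close_def by blast
      finally show "dist (\<kappa> x * v n x) (\<kappa> x * u x) < e" using n by linarith
    qed
  qed
  moreover have "continuous_on UNIV (\<lambda>x. \<kappa> x * v n x)" for n
    using v(1)[of n] Lip_b_subset_C cont by (intro continuous_intros) (auto simp: C_kappa_def)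
  ultimately have "continuous_on UNIV (\<lambda>x. \<kappa> x * u x)"
    by (intro uniform_limit_theorem[where F=sequentially]) auto
  then have "continuous_on UNIV (\<lambda>x. (\<kappa> x * u x) / \<kappa> x)"
    using cont pos by (intro continuous_on_divide) (auto simp: less_le)
  then have u_cont: "continuous_on UNIV u" by (simp add: less_imp_neq[OF pos, symmetric])
  obtain c where "close c (v 0) (\<lambda>_. 0)" using v(1)[of 0] Lip_b_subset_C C_kappaE by blast
  then have "close (1 / real (Suc 0) + c) u (\<lambda>_. 0)" using v(2)[of 0] by (rule close_trans[rotated])
  then have u_C: "u \<in> C_kappa \<kappa>" by (rule C_kappaI[OF u_cont])
  show "u \<in> UC"
    unfolding UC_kappa_def C.metric_closure_of
  proof (clarsimp simp: u_C)
    fix r :: real assume "0 < r"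
    then obtain v where v: "v \<in> Lip_b" "close (r / 2) u v" using approx by (meson half_gt_zero)
    then have "kappa_dist \<kappa> u v \<le> r / 2" using u_C Lip_b_subset_C by (subst kappa_dist_le_iff) auto
    then show "\<exists>v\<in>Lip_b. v \<in> C_kappa \<kappa> \<and> kappa_dist \<kappa> u v < r"
      using v(1) Lip_b_subset_C \<open>0 < r\<close> by (intro bexI[of _ v]) auto
  qed
qed

lemma UC_subset_C: "UC \<subseteq> C_kappa \<kappa>"
  unfolding UC_kappa_def by (rule order_trans[OF closure_of_subset_topspace]) simp

lemma Lip_b_subset_UC: "Lip_b \<subseteq> UC"
  unfolding UC_kappa_def by (rule closure_of_subset) (simp add: Lip_b_subset_C)

sublocale U: Metric_space "UC_kappa \<kappa>" "kappa_dist \<kappa>"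
  using UC_subset_C by (rule C.subspace)

lemma Lip_b_linear_combination:
  assumes u: "u \<in> Lip_b" and v: "v \<in> Lip_b"
  shows "(\<lambda>x. a * u x + b * v x) \<in> Lip_b"
proof -
  obtain B K where B: "\<forall>x. \<bar>u x\<bar> \<le> B" "K-lipschitz_on UNIV u" using u by (rule Lip_bE)
  obtain B' K' where B': "\<forall>x. \<bar>v x\<bar> \<le> B'" "K'-lipschitz_on UNIV v" using v by (rule Lip_bE)
  show ?thesis
  proof (rule Lip_bI)
    fix x
    have "\<bar>a * u x + b * v x\<bar> \<le> \<bar>a\<bar> * \<bar>u x\<bar> + \<bar>b\<bar> * \<bar>v x\<bar>"
      using abs_triangle_ineq[of "a * u x" "b * v x"] by (simp add: abs_mult)
    also have "\<dots> \<le> \<bar>a\<bar> * B + \<bar>b\<bar> * B'" using B(1) B'(1) by (intro add_mono mult_left_mono) auto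
    finally show "\<bar>a * u x + b * v x\<bar> \<le> \<bar>a\<bar> * B + \<bar>b\<bar> * B'" .
    show "(\<bar>a\<bar> * K + \<bar>b\<bar> * K')-lipschitz_on UNIV (\<lambda>x. a * u x + b * v x)"
      by (intro lipschitz_on_add lipschitz_on_cmult_real B(2) B'(2))
  qed
qed

lemma close_linear_combination:
  assumes "close c u u'" "close d v v'"
  shows "close (\<bar>a\<bar> * c + \<bar>b\<bar> * d) (\<lambda>x. a * u x + b * v x) (\<lambda>x. a * u' x + b * v' x)"
  unfolding kappa_close_def
proof
  fix x
  have "a * u x + b * v x - (a * u' x + b * v' x) = a * (u x - u' x) + b * (v x - v' x)"
    by (simp add: algebra_simps)
  then have "\<bar>a * u x + b * v x - (a * u' x + b * v' x)\<bar> \<le> \<bar>a\<bar> * \<bar>u x - u' x\<bar> + \<bar>b\<bar> * \<bar>v x - v' x\<bar>"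
    using abs_triangle_ineq[of "a * (u x - u' x)" "b * (v x - v' x)"] by (simp add: abs_mult)
  then have "\<kappa> x * \<bar>a * u x + b * v x - (a * u' x + b * v' x)\<bar>
      \<le> \<kappa> x * (\<bar>a\<bar> * \<bar>u x - u' x\<bar> + \<bar>b\<bar> * \<bar>v x - v' x\<bar>)"
    using pos[of x] by (intro mult_left_mono) auto
  also have "\<dots> = \<bar>a\<bar> * (\<kappa> x * \<bar>u x - u' x\<bar>) + \<bar>b\<bar> * (\<kappa> x * \<bar>v x - v' x\<bar>)"
    by (simp add: algebra_simps)
  also have "\<dots> \<le> \<bar>a\<bar> * c + \<bar>b\<bar> * d"
    using assms unfolding kappa_close_def by (intro add_mono mult_left_mono) auto
  finally show "\<kappa> x * \<bar>a * u x + b * v x - (a * u' x + b * v' x)\<bar> \<le> \<bar>a\<bar> * c + \<bar>b\<bar> * d" .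
qed

lemma UC_linear_combination:
  assumes u: "u \<in> UC" and v: "v \<in> UC"
  shows "(\<lambda>x. a * u x + b * v x) \<in> UC"
  unfolding UC_iff
proof (intro allI impI)
  fix \<epsilon> :: real assume \<epsilon>: "0 < \<epsilon>"
  define \<eta> where "\<eta> = \<epsilon> / (\<bar>a\<bar> + \<bar>b\<bar> + 1)"
  have "0 < \<bar>a\<bar> + \<bar>b\<bar> + 1" by linarith
  then have \<eta>: "0 < \<eta>" "(\<bar>a\<bar> + \<bar>b\<bar> + 1) * \<eta> = \<epsilon>" using \<epsilon> by (simp_all add: \<eta>_def)
  obtain u' where u': "u' \<in> Lip_b" "close \<eta> u u'" using u \<eta>(1) unfolding UC_iff by blast
  obtain v' where v': "v' \<in> Lip_b" "close \<eta> v v'" using v \<eta>(1) unfolding UC_iff by blast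
  have "close (\<bar>a\<bar> * \<eta> + \<bar>b\<bar> * \<eta>) (\<lambda>x. a * u x + b * v x) (\<lambda>x. a * u' x + b * v' x)"
    using u'(2) v'(2) by (rule close_linear_combination)
  moreover have "\<bar>a\<bar> * \<eta> + \<bar>b\<bar> * \<eta> \<le> \<epsilon>" using \<eta> by (simp add: distrib_right)
  ultimately have "close \<epsilon> (\<lambda>x. a * u x + b * v x) (\<lambda>x. a * u' x + b * v' x)"
    by (rule kappa_close_mono)
  then show "\<exists>w\<in>Lip_b. close \<epsilon> (\<lambda>x. a * u x + b * v x) w"
    using Lip_b_linear_combination[OF u'(1) v'(1)] by blast
qed

lemma UC_affine:
  assumes "u \<in> UC"
  shows "(\<lambda>x. c + a * u x) \<in> UC"
proof -
  have "(\<lambda>_. 1) \<in> UC" using const_in_Lip_b Lip_b_subset_UC by blast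
  then show ?thesis using UC_linear_combination[OF _ assms, of "\<lambda>_. 1" c a] by simp
qed

section \<open>Admissible operators\<close>

text \<open>
  This is the list of properties that the linear operators \<open>S l h\<close> share and that pass to
  compositions (the constants multiply) and to pointwise suprema (the constants stay).  The operators
  of a partition and the envelope are built from the \<open>S l h\<close> by just these two operations.
  The last clause makes bounded Lipschitz functions invariant; invariance of \<open>UC\<close> then
  follows by density, see \<open>admissible_UC\<close>.
\<close>

definition admissible :: "real \<Rightarrow> real \<Rightarrow> (('a \<Rightarrow> real) \<Rightarrow> ('a \<Rightarrow> real)) \<Rightarrow> bool" where
  "admissible a b T \<longleftrightarrow> 0 < a \<and> 0 < b \<and>
     (\<forall>u\<in>UC. \<forall>v\<in>UC. (\<forall>x. u x \<le> v x) \<longrightarrow> (\<forall>x. T u x \<le> T v x)) \<and>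
     (\<forall>u\<in>UC. \<forall>v\<in>UC. \<forall>c. close c u v \<longrightarrow> close (a * c) (T u) (T v)) \<and>
     (\<forall>u B K. (\<forall>x. \<bar>u x\<bar> \<le> B) \<longrightarrow> K-lipschitz_on UNIV u \<longrightarrow>
        (\<forall>x. \<bar>T u x\<bar> \<le> B) \<and> (b * K)-lipschitz_on UNIV (T u))"

lemma admissible_pos: "admissible a b T \<Longrightarrow> 0 < a"
  and admissible_mono:
    "admissible a b T \<Longrightarrow> u \<in> UC \<Longrightarrow> v \<in> UC \<Longrightarrow> (\<And>x. u x \<le> v x) \<Longrightarrow> T u x \<le> T v x"
  and admissible_close:
    "admissible a b T \<Longrightarrow> u \<in> UC \<Longrightarrow> v \<in> UC \<Longrightarrow> close c u v \<Longrightarrow> close (a * c) (T u) (T v)"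
  and admissible_bound:
    "admissible a b T \<Longrightarrow> (\<And>x. \<bar>u x\<bar> \<le> B) \<Longrightarrow> K-lipschitz_on UNIV u \<Longrightarrow> \<bar>T u x\<bar> \<le> B"
  and admissible_lipschitz:
    "admissible a b T \<Longrightarrow> (\<And>x. \<bar>u x\<bar> \<le> B) \<Longrightarrow> K-lipschitz_on UNIV u \<Longrightarrow> (b * K)-lipschitz_on UNIV (T u)"
  unfolding admissible_def by blast+

lemma admissible_UC:
  assumes T: "admissible a b T" and u: "u \<in> UC"
  shows "T u \<in> UC"
  unfolding UC_iff
proof (intro allI impI)
  fix \<epsilon> :: real assume "0 < \<epsilon>"
  then have "0 < \<epsilon> / a" using admissible_pos[OF T] by simp
  then obtain v where v: "v \<in> Lip_b" "close (\<epsilon> / a) u v" using u unfolding UC_iff by blast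
  then have "close (a * (\<epsilon> / a)) (T u) (T v)"
    using admissible_close[OF T u] Lip_b_subset_UC by blast
  moreover have "T v \<in> Lip_b"
    using v(1) admissible_bound[OF T] admissible_lipschitz[OF T] by (metis Lip_bE Lip_bI)
  ultimately show "\<exists>v\<in>Lip_b. close \<epsilon> (T u) v" using admissible_pos[OF T] by auto
qed

text \<open>
  An admissible operator fixes \<open>0\<close>, so its Lipschitz estimate bounds its values.  This is what
  makes the real suprema below genuine suprema.
\<close>

lemma admissible_size:
  assumes T: "admissible a b T" and u: "u \<in> UC" "close c u (\<lambda>_. 0)"
  shows "\<bar>T u x\<bar> \<le> a * c / \<kappa> x"
proof -
  have "T (\<lambda>_. 0) y = 0" for y
    using admissible_bound[OF T, of "\<lambda>_. 0" 0 0 y] by (simp add: lipschitz_on_def)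
  moreover have "close (a * c) (T u) (T (\<lambda>_. 0))"
    using admissible_close[OF T u(1) _ u(2)] const_in_Lip_b Lip_b_subset_UC by blast
  ultimately show ?thesis using closeD[of "a * c" "T u" "T (\<lambda>_. 0)" x] by simp
qed

lemma admissible_id: "admissible 1 1 (\<lambda>u. u)"
  unfolding admissible_def by simp

lemma admissible_comp:
  assumes T: "admissible a b T" and T': "admissible a' b' T'"
  shows "admissible (a * a') (b * b') (\<lambda>u. T (T' u))"
  unfolding admissible_def
proof (intro conjI ballI allI impI)
  show "0 < a * a'" "0 < b * b'" using T T' by (auto simp: admissible_def)
  show "T (T' u) x \<le> T (T' v) x" if "u \<in> UC" "v \<in> UC" "\<forall>x. u x \<le> v x" for u v x
    using that by (intro admissible_mono[OF T] admissible_UC[OF T'] admissible_mono[OF T']) auto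
  show "close (a * a' * c) (T (T' u)) (T (T' v))" if "u \<in> UC" "v \<in> UC" "close c u v" for u v c
    using that admissible_close[OF T admissible_UC[OF T'] admissible_UC[OF T'] admissible_close[OF T']]
    by (simp add: mult.assoc)
  fix u :: "'a \<Rightarrow> real" and B K assume u: "\<forall>x. \<bar>u x\<bar> \<le> B" "K-lipschitz_on UNIV u"
  have "\<bar>T' u x\<bar> \<le> B" for x using admissible_bound[OF T'] u by blast
  moreover have "(b' * K)-lipschitz_on UNIV (T' u)" using admissible_lipschitz[OF T'] u by blast
  ultimately show "\<bar>T (T' u) x\<bar> \<le> B" "(b * b' * K)-lipschitz_on UNIV (T (T' u))" for x
    using admissible_bound[OF T, of "T' u" B "b' * K" x]
      admissible_lipschitz[OF T, of "T' u" B "b' * K"] by (simp_all add: mult.assoc)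
qed

end

lemma cSUP_le_cSUP_plus:
  fixes f g :: "'i \<Rightarrow> real"
  assumes "I \<noteq> {}" "bdd_above (g ` I)" "\<And>i. i \<in> I \<Longrightarrow> f i \<le> g i + c"
  shows "(SUP i\<in>I. f i) \<le> (SUP i\<in>I. g i) + c"
proof (rule cSUP_least[OF assms(1)])
  fix i assume i: "i \<in> I"
  show "f i \<le> (SUP i\<in>I. g i) + c"
    using assms(3)[OF i] cSUP_upper[OF i assms(2)] by linarith
qed

lemma abs_cSUP_diff_le:
  fixes f g :: "'i \<Rightarrow> real"
  assumes "I \<noteq> {}" "bdd_above (f ` I)" "bdd_above (g ` I)" "\<And>i. i \<in> I \<Longrightarrow> \<bar>f i - g i\<bar> \<le> c"
  shows "\<bar>(SUP i\<in>I. f i) - (SUP i\<in>I. g i)\<bar> \<le> c"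
proof -
  have "f i \<le> g i + c" "g i \<le> f i + c" if "i \<in> I" for i using assms(4)[OF that] by auto
  then have "(SUP i\<in>I. f i) \<le> (SUP i\<in>I. g i) + c" "(SUP i\<in>I. g i) \<le> (SUP i\<in>I. f i) + c"
    using assms(1-3) by (auto intro!: cSUP_le_cSUP_plus)
  then show ?thesis by linarith
qed

context weight
begin

lemma admissible_bdd_above:
  assumes T: "\<And>i. i \<in> I \<Longrightarrow> admissible a b (T i)" and u: "u \<in> UC"
  shows "bdd_above ((\<lambda>i. T i u x) ` I)"
proof -
  obtain c where "close c u (\<lambda>_. 0)" using u UC_subset_C C_kappaE by blast
  then have "T i u x \<le> a * c / \<kappa> x" if "i \<in> I" for i
    using admissible_size[OF T[OF that] u, of c x] by linarith
  then show ?thesis by (rule bdd_aboveI2)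
qed

lemma admissible_SUP:
  assumes I: "I \<noteq> {}" and T: "\<And>i. i \<in> I \<Longrightarrow> admissible a b (T i)"
  shows "admissible a b (\<lambda>u x. SUP i\<in>I. T i u x)"
  unfolding admissible_def
proof (intro conjI ballI allI impI)
  note bdd_I = admissible_bdd_above[of I, OF T]
  show "0 < a" "0 < b" using I T by (auto simp: admissible_def)
  show "(SUP i\<in>I. T i u x) \<le> (SUP i\<in>I. T i v x)" if "u \<in> UC" "v \<in> UC" "\<forall>x. u x \<le> v x" for u v x
    using that by (intro cSUP_mono[OF I bdd_I]) (auto intro!: bexI admissible_mono[OF T])
  show "close (a * c) (\<lambda>x. SUP i\<in>I. T i u x) (\<lambda>x. SUP i\<in>I. T i v x)"
    if "u \<in> UC" "v \<in> UC" "close c u v" for u v c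
    using that
    by (intro closeI abs_cSUP_diff_le I bdd_I) (auto intro!: closeD admissible_close[OF T])
  fix u :: "'a \<Rightarrow> real" and B K assume u: "\<forall>x. \<bar>u x\<bar> \<le> B" "K-lipschitz_on UNIV u"
  then have u_UC: "u \<in> UC" using Lip_bI Lip_b_subset_UC by blast
  show "\<bar>SUP i\<in>I. T i u x\<bar> \<le> B" for x
    using u by (intro cSup_abs_le) (auto simp: I intro!: admissible_bound[OF T])
  show "(b * K)-lipschitz_on UNIV (\<lambda>x. SUP i\<in>I. T i u x)"
  proof (rule lipschitz_onI)
    fix x y
    have "\<bar>T i u x - T i u y\<bar> \<le> b * K * dist x y" if "i \<in> I" for i
      using lipschitz_onD[OF admissible_lipschitz[OF T[OF that], of u B K], of x y] u
      by (simp add: dist_real_def)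
    then show "dist (SUP i\<in>I. T i u x) (SUP i\<in>I. T i u y) \<le> b * K * dist x y"
      unfolding dist_real_def using bdd_I[OF _ u_UC] by (intro abs_cSUP_diff_le I) auto
    show "0 \<le> b * K" using \<open>0 < b\<close> lipschitz_on_nonneg[OF u(2)] by simp
  qed
qed

end

section \<open>Compositions along time_chains of times\<close>

lemma upper_op_list_append:
  "upper_op_list \<Lambda> S (xs @ s # ys) u = upper_op_list \<Lambda> S (xs @ [s]) (upper_op_list \<Lambda> S (s # ys) u)"
proof (induction xs)
  case (Cons x xs)
  then show ?case by (cases xs) auto
qed simp

lemma sorted_last_eqI:
  fixes t :: real
  assumes "sorted xs" "t \<in> set xs" "\<And>y. y \<in> set xs \<Longrightarrow> y \<le> t"
  shows "last xs = t"
proof -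
  have "xs = butlast xs @ [last xs]" using assms(2) by (cases xs) auto
  then have "y \<le> last xs" if "y \<in> set xs" for y
    using assms(1) that sorted_append[of "butlast xs" "[last xs]"]
    by (metis Un_iff empty_iff empty_set list.set(2) order_refl set_append insert_iff)
  moreover have "last xs \<in> set xs" using assms(2) by (cases xs) auto
  ultimately show ?thesis using assms(2,3) by (simp add: order_antisym)
qed

lemma sorted_le_last:
  fixes xs :: "real list"
  assumes "sorted xs" "y \<in> set xs"
  shows "y \<le> last xs"
  using assms by (induction xs) auto

text \<open>
  A partition of \<open>[0, t]\<close> in increasing order, with its first entry \<open>0\<close> left out, so that all
  statements can be about the nonempty lists \<open>0 # ts\<close>.
\<close>

definition time_chains :: "real \<Rightarrow> real list set" where
  "time_chains t = {ts. sorted_wrt (<) (0 # ts) \<and> last (0 # ts) = t}"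

lemma time_chains_nonempty: "0 \<le> t \<Longrightarrow> time_chains t \<noteq> {}"
proof -
  assume "0 \<le> t"
  then have "(if t = 0 then [] else [t]) \<in> time_chains t" by (auto simp: time_chains_def)
  then show ?thesis by blast
qed

lemma partitions_eq_time_chains: "sorted_list_of_set ` partitions t = (#) 0 ` time_chains t"
proof (intro equalityI subsetI)
  fix xs assume "xs \<in> sorted_list_of_set ` partitions t"
  then obtain \<pi> where \<pi>: "finite \<pi>" "\<pi> \<subseteq> {0..}" "0 \<in> \<pi>" "Max \<pi> = t" and xs: "xs = sorted_list_of_set \<pi>"
    by (auto simp: partitions_def)
  have set: "set xs = \<pi>" and sorted: "sorted_wrt (<) xs" using \<pi>(1) by (simp_all add: xs)
  obtain y ys where ys: "xs = y # ys" using set \<pi>(3) by (cases xs) auto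
  have "y = 0" using sorted \<pi>(2,3) set unfolding ys by force
  moreover have "last xs = t"
    using \<pi> sorted set by (intro sorted_last_eqI) (auto simp: strict_sorted_iff intro: Max_in)
  ultimately show "xs \<in> (#) 0 ` time_chains t" using sorted unfolding ys time_chains_def by auto
next
  fix xs assume "xs \<in> (#) 0 ` time_chains t"
  then obtain ts where ts: "xs = 0 # ts" "sorted_wrt (<) xs" "last xs = t" by (auto simp: time_chains_def)
  then have sorted: "sorted xs" by (simp only: strict_sorted_iff)
  have "set xs \<subseteq> {0..}" using sorted unfolding ts(1) by auto
  moreover have "Max (set xs) = t"
    using ts sorted_le_last[OF sorted] by (intro Max_eqI) auto
  ultimately have "set xs \<in> partitions t" using ts(1) by (auto simp: partitions_def)
  moreover have "sorted_list_of_set (set xs) = xs"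
    using ts(2) by (simp add: strict_sorted_iff sorted_list_of_set.idem_if_sorted_distinct)
  ultimately show "xs \<in> sorted_list_of_set ` partitions t" by (metis imageI)
qed

lemma envelope_eq_SUP_time_chains:
  "envelope \<Lambda> S t u x = (SUP ts\<in>time_chains t. upper_op_list \<Lambda> S (0 # ts) u x)"
proof -
  have "(\<lambda>\<pi>. upper_op_partition \<Lambda> S \<pi> u x) ` partitions t
      = (\<lambda>xs. upper_op_list \<Lambda> S xs u x) ` (sorted_list_of_set ` partitions t)"
    by (simp add: upper_op_partition_def image_image)
  also have "\<dots> = (\<lambda>ts. upper_op_list \<Lambda> S (0 # ts) u x) ` time_chains t"
    by (simp add: partitions_eq_time_chains image_image)
  finally show ?thesis by (simp add: envelope_def)
qed

locale semigroup_family = weight \<kappa>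
  for \<kappa> :: "'a::metric_space \<Rightarrow> real" +
  fixes \<Lambda> :: "'l set"
    and S :: "'l \<Rightarrow> real \<Rightarrow> ('a \<Rightarrow> real) \<Rightarrow> ('a \<Rightarrow> real)"
    and \<alpha> \<beta> :: real
  assumes nonempty: "\<Lambda> \<noteq> {}"
    and \<alpha>_nonneg: "0 \<le> \<alpha>"
    and S_admissible: "l \<in> \<Lambda> \<Longrightarrow> 0 \<le> h \<Longrightarrow> admissible (exp (\<alpha> * h)) (exp (\<beta> * h)) (S l h)"
    and S_add: "l \<in> \<Lambda> \<Longrightarrow> 0 \<le> s \<Longrightarrow> 0 \<le> t \<Longrightarrow> u \<in> UC_kappa \<kappa> \<Longrightarrow> S l (s + t) u = S l s (S l t u)"
    and S_affine: "l \<in> \<Lambda> \<Longrightarrow> 0 \<le> h \<Longrightarrow> u \<in> UC_kappa \<kappa> \<Longrightarrow>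
      S l h (\<lambda>x. c + a * u x) = (\<lambda>x. c + a * S l h u x)"
begin

abbreviation E :: "real \<Rightarrow> ('a \<Rightarrow> real) \<Rightarrow> ('a \<Rightarrow> real)" where
  "E \<equiv> upper_op \<Lambda> S"

abbreviation EL :: "real list \<Rightarrow> ('a \<Rightarrow> real) \<Rightarrow> ('a \<Rightarrow> real)" where
  "EL \<equiv> upper_op_list \<Lambda> S"

lemma E_admissible: "0 \<le> h \<Longrightarrow> admissible (exp (\<alpha> * h)) (exp (\<beta> * h)) (E h)"
  using admissible_SUP[OF nonempty S_admissible] by (simp add: upper_op_def[abs_def])

lemma EL_admissible:
  assumes "sorted (s # ts)"
  shows "admissible (exp (\<alpha> * (last (s # ts) - s))) (exp (\<beta> * (last (s # ts) - s))) (EL (s # ts))"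
  using assms
proof (induction ts arbitrary: s)
  case Nil
  have "EL [s] = (\<lambda>u. u)" by (rule ext) simp
  then show ?case using admissible_id by simp
next
  case (Cons t ts)
  define l where "l = last (t # ts)"
  have "admissible (exp (\<alpha> * (t - s)) * exp (\<alpha> * (l - t))) (exp (\<beta> * (t - s)) * exp (\<beta> * (l - t)))
      (\<lambda>u. E (t - s) (EL (t # ts) u))"
    using Cons by (intro admissible_comp E_admissible) (auto simp: l_def)
  moreover have "EL (s # t # ts) = (\<lambda>u. E (t - s) (EL (t # ts) u))" by (rule ext) simp
  ultimately show ?case by (simp add: l_def flip: exp_add distrib_left)
qed

lemma S_le_E: "l \<in> \<Lambda> \<Longrightarrow> 0 \<le> h \<Longrightarrow> u \<in> UC \<Longrightarrow> S l h u x \<le> E h u x"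
  unfolding upper_op_def by (rule cSUP_upper[OF _ admissible_bdd_above[OF S_admissible]]) auto

text \<open>
  Choosing the index anew at an intermediate time can only increase the supremum.  Hence refining a
  partition increases the associated operator.
\<close>

lemma E_add_le:
  assumes "0 \<le> s" "0 \<le> t" "u \<in> UC"
  shows "E (s + t) u x \<le> E s (E t u) x"
  unfolding upper_op_def[of \<Lambda> S "s + t"]
proof (rule cSUP_least[OF nonempty])
  fix l assume l: "l \<in> \<Lambda>"
  have Et: "E t u \<in> UC" by (intro admissible_UC[OF E_admissible] assms)
  have St: "S l t u \<in> UC" by (intro admissible_UC[OF S_admissible] assms l)
  have "S l s (S l t u) x \<le> S l s (E t u) x"
    by (intro admissible_mono[OF S_admissible] S_le_E l assms St Et)
  also have "\<dots> \<le> E s (E t u) x" by (intro S_le_E l assms Et)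
  finally show "S l (s + t) u x \<le> E s (E t u) x" using S_add[OF l assms] by simp
qed

lemma EL_le_insort:
  assumes "sorted (r # ts)" "r < s" "s < last (r # ts)" "s \<notin> set ts" "u \<in> UC"
  shows "EL (r # ts) u x \<le> EL (r # insort s ts) u x"
  using assms
proof (induction ts arbitrary: r x)
  case (Cons t ts)
  then have UC: "EL (t # ts) u \<in> UC" by (intro admissible_UC[OF EL_admissible]) auto
  show ?case
  proof (cases "s < t")
    case True
    then show ?thesis using E_add_le[of "s - r" "t - s" _ x] UC Cons.prems by simp
  next
    case False
    then have "t < s" using Cons.prems by simp
    have "sorted (t # insort s ts)" using Cons.prems \<open>t < s\<close> by (auto simp: set_insort_key sorted_insort)
    then have UC': "EL (t # insort s ts) u \<in> UC"
      by (intro admissible_UC[OF EL_admissible] Cons.prems)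
    have "EL (t # ts) u y \<le> EL (t # insort s ts) u y" for y
      using Cons \<open>t < s\<close> by (auto split: if_splits)
    then have "E (t - r) (EL (t # ts) u) x \<le> E (t - r) (EL (t # insort s ts) u) x"
      using Cons.prems UC UC' by (intro admissible_mono[OF E_admissible]) auto
    then show ?thesis using \<open>t < s\<close> by simp
  qed
qed simp

lemma E_increment:
  assumes "\<And>l. l \<in> \<Lambda> \<Longrightarrow> close c (S l h v) v"
  shows "close c (E h v) v"
  unfolding upper_op_def
proof (rule closeI)
  fix x
  show "\<bar>(SUP l\<in>\<Lambda>. S l h v x) - v x\<bar> \<le> c / \<kappa> x"
    using nonempty closeD[OF assms] by (intro cSup_asclose) auto
qed

text \<open>
  The increments over the steps of a chain telescope.  Each is of size at most \<open>D\<close> times its step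
  and is then transported by the operators to its left, which costs at most one factor
  \<open>exp (\<alpha> * (last (s # ts) - s))\<close> altogether.
\<close>

lemma EL_increment:
  assumes v: "v \<in> UC" and D: "0 \<le> D"
    and step: "\<And>h l. 0 \<le> h \<Longrightarrow> h < \<rho> \<Longrightarrow> l \<in> \<Lambda> \<Longrightarrow> close (D * h) (S l h v) v"
    and ts: "sorted (s # ts)" "last (s # ts) - s < \<rho>"
  shows "close (exp (\<alpha> * (last (s # ts) - s)) * (D * (last (s # ts) - s))) (EL (s # ts) v) v"
  using ts
proof (induction ts arbitrary: s)
  case Nil
  then show ?case by (simp add: kappa_close_def)
next
  case (Cons t ts)
  define l where "l = last (t # ts)"
  have st: "s \<le> t" "t \<le> l" "l - s < \<rho>" "sorted (t # ts)"
    using Cons.prems sorted_le_last[of "t # ts" t] by (auto simp: l_def)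
  have "close (exp (\<alpha> * (l - t)) * (D * (l - t))) (EL (t # ts) v) v"
    using Cons.IH st by (auto simp: l_def)
  then have "close (exp (\<alpha> * (t - s)) * (exp (\<alpha> * (l - t)) * (D * (l - t))))
      (E (t - s) (EL (t # ts) v)) (E (t - s) v)"
    using st v by (intro admissible_close[OF E_admissible] admissible_UC[OF EL_admissible]) auto
  moreover have "close (D * (t - s)) (E (t - s) v) v"
    using st by (intro E_increment step) auto
  ultimately have "close (exp (\<alpha> * (t - s)) * (exp (\<alpha> * (l - t)) * (D * (l - t))) + D * (t - s))
      (EL (s # t # ts) v) v"
    by (auto dest: close_trans)
  moreover have "exp (\<alpha> * (t - s)) * (exp (\<alpha> * (l - t)) * (D * (l - t))) + D * (t - s)
      \<le> exp (\<alpha> * (l - s)) * (D * (l - s))"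
  proof -
    have "exp (\<alpha> * (t - s)) * exp (\<alpha> * (l - t)) = exp (\<alpha> * (l - s))"
      by (simp flip: exp_add distrib_left)
    moreover have "1 * (D * (t - s)) \<le> exp (\<alpha> * (l - s)) * (D * (t - s))"
      using st D \<alpha>_nonneg by (intro mult_right_mono) auto
    ultimately show ?thesis by (simp add: algebra_simps)
  qed
  ultimately show ?case unfolding l_def by (auto intro: kappa_close_mono)
qed

section \<open>Small increments near time zero\<close>

text \<open>
  The chains start at an arbitrary time \<open>s\<close>, because the definition is applied to the part of a
  partition that lies to the right of \<open>s\<close>.
\<close>

definition increments_vanish :: "('a \<Rightarrow> real) \<Rightarrow> bool" where
  "increments_vanish u \<longleftrightarrow> (\<forall>\<epsilon>>0. \<exists>r>0. \<forall>s ts. sorted (s # ts) \<longrightarrow> last (s # ts) - s < r \<longrightarrow>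
     close \<epsilon> (EL (s # ts) u) u)"

text \<open>
  At a point \<open>x\<close>, a function \<open>u\<close> bounded by \<open>B\<close> with Lipschitz constant \<open>K\<close> lies between
  the two models \<open>u x \<plusminus> (K * \<delta> + 2 * B * \<phi> x y)\<close>: within distance \<open>\<delta>\<close> the Lipschitz estimate
  applies, and beyond it \<open>\<phi> x\<close> equals \<open>1\<close>.  The models are affine in \<open>\<phi> x\<close>, so each \<open>S l h\<close>
  moves them by at most \<open>2 * B * L * h\<close>, uniformly in \<open>x\<close>.  Thus \<open>EL_increment\<close> controls them
  along chains, and monotonicity transfers the control to \<open>u\<close> at \<open>x\<close>, where \<open>\<phi> x\<close> vanishes.
\<close>

lemma increments_vanish_Lip_b:
  assumes barrier: "\<And>\<delta>::real. 0 < \<delta> \<Longrightarrow> \<exists>\<phi> L \<rho>. (\<forall>x. \<phi> x \<in> UC \<and> (\<forall>y. 0 \<le> \<phi> x y) \<and> \<phi> x x = 0 \<and>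
      (\<forall>y. \<delta> \<le> dist x y \<longrightarrow> \<phi> x y = 1)) \<and> 0 \<le> L \<and> 0 < \<rho> \<and>
      (\<forall>h x. \<forall>l\<in>\<Lambda>. 0 \<le> h \<longrightarrow> h < \<rho> \<longrightarrow> close (L * h) (S l h (\<phi> x)) (\<phi> x))"
    and u: "u \<in> Lip_b"
  shows "increments_vanish u"
  unfolding increments_vanish_def
proof (intro allI impI)
  fix \<epsilon> :: real assume \<epsilon>: "0 < \<epsilon>"
  obtain B K where B: "\<forall>x. \<bar>u x\<bar> \<le> B" and K: "K-lipschitz_on UNIV u" using u by (rule Lip_bE)
  have B0: "0 \<le> B" using B by (meson abs_ge_zero order_trans)
  have K0: "0 \<le> K" using K by (rule lipschitz_on_nonneg)
  obtain C where C: "0 < C" "\<forall>x. \<kappa> x \<le> C" by (rule kappa_upper)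
  \<comment> \<open>This makes the Lipschitz error \<open>\<kappa> x * (K * \<delta>)\<close> at most \<open>\<epsilon> / 2\<close>; \<open>K + 1\<close> covers \<open>K = 0\<close>.\<close>
  define \<delta> where "\<delta> = \<epsilon> / (2 * C * (K + 1))"
  have \<delta>: "0 < \<delta>" using \<epsilon> C K0 by (simp add: \<delta>_def)
  have C\<delta>: "C * (K * \<delta>) \<le> \<epsilon> / 2"
    using \<epsilon> C K0 by (simp add: \<delta>_def divide_simps)
  obtain \<phi> L \<rho> where \<phi>: "\<And>x. \<phi> x \<in> UC" "\<And>x y. 0 \<le> \<phi> x y" "\<And>x. \<phi> x x = 0"
      "\<And>x y. \<delta> \<le> dist x y \<Longrightarrow> \<phi> x y = 1" and L: "0 \<le> L" and \<rho>: "0 < \<rho>"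
    and step: "\<And>h x l. l \<in> \<Lambda> \<Longrightarrow> 0 \<le> h \<Longrightarrow> h < \<rho> \<Longrightarrow> close (L * h) (S l h (\<phi> x)) (\<phi> x)"
    using barrier[OF \<delta>] by blast
  define D where "D = 2 * B * L"
  have D: "0 \<le> D" using B0 L by (simp add: D_def)
  define r where "r = min \<rho> (min 1 (\<epsilon> / (2 * (exp \<alpha> * (D + 1)))))"
  have r: "0 < r" using \<rho> \<epsilon> D by (auto simp: r_def intro!: mult_pos_pos)
  show "\<exists>r>0. \<forall>s ts. sorted (s # ts) \<longrightarrow> last (s # ts) - s < r \<longrightarrow> close \<epsilon> (EL (s # ts) u) u"
  proof (intro exI[of _ r] conjI allI impI r)
    fix s ts assume ts: "sorted (s # ts)" "last (s # ts) - s < r"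
    define \<tau> where "\<tau> = last (s # ts) - s"
    have \<tau>: "0 \<le> \<tau>" "\<tau> < r" using ts sorted_le_last[of "s # ts" s] by (auto simp: \<tau>_def)
    have small: "exp (\<alpha> * \<tau>) * (D * \<tau>) \<le> \<epsilon> / 2"
    proof -
      have "\<alpha> * \<tau> \<le> \<alpha> * 1" using \<tau> \<alpha>_nonneg by (intro mult_left_mono) (auto simp: r_def)
      then have "exp (\<alpha> * \<tau>) * (D * \<tau>) \<le> exp \<alpha> * ((D + 1) * \<tau>)"
        using \<tau> D by (intro mult_mono) auto
      also have "\<dots> = (exp \<alpha> * (D + 1)) * \<tau>" by simp
      also have "\<dots> \<le> (exp \<alpha> * (D + 1)) * (\<epsilon> / (2 * (exp \<alpha> * (D + 1))))"
        using \<tau> D by (intro mult_left_mono) (auto simp: r_def)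
      also have "\<dots> = \<epsilon> / 2" using D by (simp add: divide_simps)
      finally show ?thesis .
    qed
    \<comment> \<open>The upper model has \<open>a = 2 * B\<close>, the lower one \<open>a = - (2 * B)\<close>.\<close>
    have model: "close (\<epsilon> / 2) (EL (s # ts) (\<lambda>y. c + a * \<phi> x y)) (\<lambda>y. c + a * \<phi> x y)"
      if a: "\<bar>a\<bar> = 2 * B" for a c x
    proof -
      have "close (D * h) (S l h (\<lambda>y. c + a * \<phi> x y)) (\<lambda>y. c + a * \<phi> x y)"
        if h: "0 \<le> h" "h < \<rho>" "l \<in> \<Lambda>" for h l
        unfolding kappa_close_def
      proof
        fix y
        have "\<kappa> y * \<bar>S l h (\<lambda>y. c + a * \<phi> x y) y - (c + a * \<phi> x y)\<bar>
            = \<bar>a\<bar> * (\<kappa> y * \<bar>S l h (\<phi> x) y - \<phi> x y\<bar>)"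
          using h by (simp add: S_affine \<phi>(1) abs_mult flip: right_diff_distrib)
        also have "\<dots> \<le> \<bar>a\<bar> * (L * h)"
          using step[of l h x] h unfolding kappa_close_def by (intro mult_left_mono) auto
        finally show "\<kappa> y * \<bar>S l h (\<lambda>y. c + a * \<phi> x y) y - (c + a * \<phi> x y)\<bar> \<le> D * h"
          by (simp add: a D_def)
      qed
      then have "close (exp (\<alpha> * \<tau>) * (D * \<tau>)) (EL (s # ts) (\<lambda>y. c + a * \<phi> x y)) (\<lambda>y. c + a * \<phi> x y)"
        unfolding \<tau>_def using ts
        by (intro EL_increment[where \<rho>=\<rho>] UC_affine \<phi>(1) D) (auto simp: r_def)
      then show ?thesis using small by (rule kappa_close_mono)
    qed
    show "close \<epsilon> (EL (s # ts) u) u"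
      unfolding kappa_close_def
    proof
      fix x
      have near: "\<bar>u y - u x\<bar> \<le> K * \<delta> + 2 * B * \<phi> x y" for y
      proof (cases "\<delta> \<le> dist x y")
        case True
        have "\<bar>u y - u x\<bar> \<le> 2 * B" using B[rule_format, of x] B[rule_format, of y] by linarith
        moreover have "0 \<le> K * \<delta>" using K0 \<delta> by simp
        ultimately show ?thesis using True \<phi>(4) by simp
      next
        case False
        have "\<bar>u y - u x\<bar> \<le> K * dist x y"
          using lipschitz_onD[OF K, of y x] by (simp add: dist_real_def dist_commute)
        also have "\<dots> \<le> K * \<delta>" using False K0 by (intro mult_left_mono) auto
        finally show ?thesis using B0 \<phi>(2)[of x y] by (simp add: add_increasing2)
      qed
      have adm: "admissible (exp (\<alpha> * \<tau>)) (exp (\<beta> * \<tau>)) (EL (s # ts))"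
        unfolding \<tau>_def using ts(1) by (rule EL_admissible)
      have u_UC: "u \<in> UC" using u Lip_b_subset_UC by blast
      have "EL (s # ts) u x \<le> EL (s # ts) (\<lambda>y. (u x + K * \<delta>) + (2 * B) * \<phi> x y) x"
      proof (rule admissible_mono[OF adm u_UC UC_affine[OF \<phi>(1)]])
        show "u y \<le> u x + K * \<delta> + 2 * B * \<phi> x y" for y using near[of y] by linarith
      qed
      also have "\<dots> \<le> u x + K * \<delta> + (\<epsilon> / 2) / \<kappa> x"
        using closeD[OF model[of "2 * B" "u x + K * \<delta>" x], of x] B0 \<phi>(3) by simp
      finally have upper: "EL (s # ts) u x - u x \<le> K * \<delta> + (\<epsilon> / 2) / \<kappa> x" by simp
      have "EL (s # ts) (\<lambda>y. (u x - K * \<delta>) + (- (2 * B)) * \<phi> x y) x \<le> EL (s # ts) u x"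
      proof (rule admissible_mono[OF adm UC_affine[OF \<phi>(1)] u_UC])
        show "u x - K * \<delta> + (- (2 * B)) * \<phi> x y \<le> u y" for y using near[of y] by (simp add: abs_le_iff)
      qed
      moreover have "u x - K * \<delta> - (\<epsilon> / 2) / \<kappa> x \<le> EL (s # ts) (\<lambda>y. (u x - K * \<delta>) + (- (2 * B)) * \<phi> x y) x"
        using closeD[OF model[of "- (2 * B)" "u x - K * \<delta>" x], of x] B0 \<phi>(3) by simp
      ultimately have "\<bar>EL (s # ts) u x - u x\<bar> \<le> K * \<delta> + (\<epsilon> / 2) / \<kappa> x" using upper by linarith
      then have "\<kappa> x * \<bar>EL (s # ts) u x - u x\<bar> \<le> \<kappa> x * (K * \<delta> + (\<epsilon> / 2) / \<kappa> x)"
        using pos[of x] by (intro mult_left_mono) auto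
      also have "\<dots> = \<kappa> x * (K * \<delta>) + \<epsilon> / 2" using pos[of x] by (simp add: distrib_left)
      also have "\<dots> \<le> C * (K * \<delta>) + \<epsilon> / 2" using C K0 \<delta> by (intro add_right_mono mult_right_mono) auto
      finally show "\<kappa> x * \<bar>EL (s # ts) u x - u x\<bar> \<le> \<epsilon>" using C\<delta> by linarith
    qed
  qed
qed

lemma increments_vanish_UC:
  assumes "\<And>v. v \<in> Lip_b \<Longrightarrow> increments_vanish v" and u: "u \<in> UC"
  shows "increments_vanish u"
  unfolding increments_vanish_def
proof (intro allI impI)
  fix \<epsilon> :: real assume \<epsilon>: "0 < \<epsilon>"
  define \<eta> where "\<eta> = \<epsilon> / (2 * (exp \<alpha> + 1))"
  have \<eta>: "0 < \<eta>" "(exp \<alpha> + 1) * \<eta> = \<epsilon> / 2"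
    using \<epsilon> add_pos_pos[OF exp_gt_zero[of \<alpha>] zero_less_one] by (auto simp: \<eta>_def field_simps)
  obtain v where v: "v \<in> Lip_b" "close \<eta> u v" using u \<eta> unfolding UC_iff by blast
  have v_UC: "v \<in> UC" using v Lip_b_subset_UC by blast
  obtain r where r: "0 < r"
      "\<And>s ts. sorted (s # ts) \<Longrightarrow> last (s # ts) - s < r \<Longrightarrow> close (\<epsilon> / 2) (EL (s # ts) v) v"
    using assms(1)[OF v(1)] \<epsilon> unfolding increments_vanish_def by (meson half_gt_zero)
  show "\<exists>r>0. \<forall>s ts. sorted (s # ts) \<longrightarrow> last (s # ts) - s < r \<longrightarrow> close \<epsilon> (EL (s # ts) u) u"
  proof (intro exI[of _ "min r 1"] conjI allI impI)
    fix s ts assume ts: "sorted (s # ts)" "last (s # ts) - s < min r 1"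
    have "close (exp (\<alpha> * (last (s # ts) - s)) * \<eta>) (EL (s # ts) u) (EL (s # ts) v)"
      using admissible_close[OF EL_admissible[OF ts(1)] u v_UC v(2)] .
    moreover have "\<alpha> * (last (s # ts) - s) \<le> \<alpha> * 1" using ts \<alpha>_nonneg by (intro mult_left_mono) auto
    ultimately have "close (exp \<alpha> * \<eta>) (EL (s # ts) u) (EL (s # ts) v)"
      using \<eta>(1) by (auto elim!: kappa_close_mono)
    moreover have "close (\<epsilon> / 2) (EL (s # ts) v) v" using r(2) ts by simp
    moreover have "close \<eta> v u" using v(2) by (simp add: kappa_close_commute)
    ultimately have "close (exp \<alpha> * \<eta> + (\<epsilon> / 2) + \<eta>) (EL (s # ts) u) u"
      by (blast intro: close_trans)
    moreover have "exp \<alpha> * \<eta> + (\<epsilon> / 2) + \<eta> = \<epsilon>" using \<eta>(2) by (simp add: algebra_simps)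
    ultimately show "close \<epsilon> (EL (s # ts) u) u" by simp
  qed (use r in simp)
qed

section \<open>Strong continuity of the envelope\<close>

lemma EL_chain_admissible:
  "ts \<in> time_chains t \<Longrightarrow> admissible (exp (\<alpha> * t)) (exp (\<beta> * t)) (EL (0 # ts))"
  using EL_admissible[of 0 ts] strict_sorted_iff[of "0 # ts"] unfolding time_chains_def by auto

lemma envelope_admissible: "0 \<le> t \<Longrightarrow> admissible (exp (\<alpha> * t)) (exp (\<beta> * t)) (envelope \<Lambda> S t)"
  using admissible_SUP[OF time_chains_nonempty EL_chain_admissible]
  by (simp add: envelope_eq_SUP_time_chains[abs_def] del: upper_op_list.simps)

lemma EL_le_envelope: "ts \<in> time_chains t \<Longrightarrow> u \<in> UC \<Longrightarrow> EL (0 # ts) u x \<le> envelope \<Lambda> S t u x"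
  unfolding envelope_eq_SUP_time_chains
  by (rule cSUP_upper[OF _ admissible_bdd_above[OF EL_chain_admissible]])

text \<open>
  Inserting \<open>s\<close> into a partition of \<open>[0, t]\<close> only increases its operator, which then factors into
  the operators of a partition of \<open>[0, s]\<close> and of a chain from \<open>s\<close> to \<open>t\<close>.
\<close>

lemma refine_through:
  assumes ts: "ts \<in> time_chains t" and s: "0 \<le> s" "s \<le> t" and u: "u \<in> UC"
  obtains ts' ys where "ts' \<in> time_chains s" "sorted (s # ys)" "last (s # ys) = t"
    "EL (0 # ts) u x \<le> EL (0 # ts') (EL (s # ys) u) x"
proof -
  have sorted: "sorted (0 # ts)" and dist: "distinct (0 # ts)" and last: "last (0 # ts) = t"
    using ts by (auto simp: time_chains_def strict_sorted_iff)
  obtain zs where zs: "sorted_wrt (<) (0 # zs)" "last (0 # zs) = t" "s \<in> set (0 # zs)"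
      "EL (0 # ts) u x \<le> EL (0 # zs) u x"
  proof (cases "s \<in> set (0 # ts)")
    case True
    then show ?thesis using ts that[of ts] by (auto simp: time_chains_def)
  next
    case False
    then have s': "0 < s" "s < t" using s last by (auto simp: less_le split: if_splits)
    have "sorted (0 # insort s ts)" "distinct (0 # insort s ts)"
      using sorted dist False s by (auto simp: sorted_insort set_insort_key distinct_insort)
    moreover from this have "last (0 # insort s ts) = t"
      using s sorted_le_last[OF sorted] last last_in_set[of "0 # ts"]
      by (intro sorted_last_eqI) (auto simp: set_insort_key)
    moreover have "EL (0 # ts) u x \<le> EL (0 # insort s ts) u x"
      using False s' last by (intro EL_le_insort sorted u) auto
    ultimately show ?thesis
      using that[of "insort s ts"] strict_sorted_iff[of "0 # insort s ts"] by (simp add: set_insort_key)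
  qed
  obtain xs ys where split: "0 # zs = xs @ s # ys" using zs(3) by (meson split_list)
  define ts' where "ts' = tl (xs @ [s])"
  have ts': "0 # ts' = xs @ [s]" using split by (cases xs) (auto simp: ts'_def)
  have "sorted_wrt (<) (xs @ [s])" "sorted_wrt (<) (s # ys)"
    using zs(1) unfolding split by (auto simp: sorted_wrt_append)
  moreover have "last (s # ys) = t" using zs(2) unfolding split by simp
  moreover have "EL (0 # zs) u x = EL (0 # ts') (EL (s # ys) u) x"
    unfolding split ts' by (subst upper_op_list_append) simp
  ultimately show ?thesis
    using zs(4) ts' strict_sorted_iff[of "s # ys"]
    by (intro that[of ts' ys]) (auto simp: time_chains_def simp del: sorted_wrt.simps last.simps)
qed

text \<open>
  Both envelopes are compared partition by partition: each partition of \<open>[0, t]\<close> may be taken to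
  pass through \<open>s\<close>, and each partition of \<open>[0, s]\<close> extends to one of \<open>[0, t]\<close>.  In either case
  the operator over \<open>[0, s]\<close> acts on \<open>u\<close> and on a function at distance \<open>c\<close> from \<open>u\<close>.
\<close>

lemma envelope_increment:
  assumes u: "u \<in> UC" and s: "0 \<le> s" "s \<le> t"
    and inc: "\<And>ys. sorted (s # ys) \<Longrightarrow> last (s # ys) = t \<Longrightarrow> close c (EL (s # ys) u) u"
  shows "close (exp (\<alpha> * s) * c) (envelope \<Lambda> S t u) (envelope \<Lambda> S s u)"
proof (rule closeI)
  fix x
  let ?e = "exp (\<alpha> * s) * c / \<kappa> x"
  have compare: "\<bar>EL (0 # ts) (EL (s # ys) u) x - EL (0 # ts) u x\<bar> \<le> ?e"
    if "ts \<in> time_chains s" "sorted (s # ys)" "last (s # ys) = t" for ts ys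
    using closeD[OF admissible_close[OF EL_chain_admissible[OF that(1)]
          admissible_UC[OF EL_admissible[OF that(2)] u] u inc[OF that(2,3)]], of x] .
  have "envelope \<Lambda> S t u x \<le> envelope \<Lambda> S s u x + ?e"
    unfolding envelope_eq_SUP_time_chains[of \<Lambda> S t]
  proof (rule cSUP_least)
    show "time_chains t \<noteq> {}" using s by (intro time_chains_nonempty) simp
    fix ts assume "ts \<in> time_chains t"
    then obtain ts' ys where "ts' \<in> time_chains s" "sorted (s # ys)" "last (s # ys) = t"
      "EL (0 # ts) u x \<le> EL (0 # ts') (EL (s # ys) u) x"
      using refine_through s u by metis
    then show "EL (0 # ts) u x \<le> envelope \<Lambda> S s u x + ?e"
      using compare[of ts' ys] EL_le_envelope[of ts' s u x] u by linarith
  qed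
  moreover have "envelope \<Lambda> S s u x \<le> envelope \<Lambda> S t u x + ?e"
    unfolding envelope_eq_SUP_time_chains[of \<Lambda> S s]
  proof (rule cSUP_least)
    show "time_chains s \<noteq> {}" using s by (intro time_chains_nonempty) simp
    fix ts assume ts: "ts \<in> time_chains s"
    \<comment> \<open>Chains increase strictly, so \<open>t\<close> must not be appended when it is already the last time.\<close>
    define ys where "ys = (if s = t then [] else [t])"
    have ys: "sorted (s # ys)" "last (s # ys) = t" using s by (auto simp: ys_def)
    define xs where "xs = butlast (0 # ts)"
    have xs: "0 # ts = xs @ [s]"
      using ts append_butlast_last_id[of "0 # ts"] by (simp add: time_chains_def xs_def)
    then have xs': "0 # (ts @ ys) = xs @ s # ys" by (metis append.assoc append_Cons append_Nil)
    have "sorted_wrt (<) (xs @ [s])" using ts unfolding xs[symmetric] by (simp add: time_chains_def)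
    then have "sorted_wrt (<) (xs @ s # ys)"
      using s by (auto simp: ys_def sorted_wrt_append intro: less_trans)
    then have "ts @ ys \<in> time_chains t"
      using ys(2) unfolding time_chains_def mem_Collect_eq xs' by simp
    moreover have "EL (0 # (ts @ ys)) u x = EL (0 # ts) (EL (s # ys) u) x"
      unfolding xs xs' by (subst upper_op_list_append) simp
    ultimately show "EL (0 # ts) u x \<le> envelope \<Lambda> S t u x + ?e"
      using compare[OF ts ys] EL_le_envelope[of "ts @ ys" t u x] u by linarith
  qed
  ultimately show "\<bar>envelope \<Lambda> S t u x - envelope \<Lambda> S s u x\<bar> \<le> ?e" by linarith
qed

lemma envelope_strongly_continuous:
  assumes "\<And>u. u \<in> Lip_b \<Longrightarrow> increments_vanish u"
  shows "strongly_continuous \<kappa> (envelope \<Lambda> S)"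
  unfolding strongly_continuous_def UC_topology_def U.continuous_map_to_metric
proof (intro ballI allI impI)
  fix u t and \<epsilon> :: real
  assume u: "u \<in> UC" and t: "t \<in> topspace (top_of_set {0::real..})" and \<epsilon>: "0 < \<epsilon>"
  have t0: "0 \<le> t" using t by simp
  \<comment> \<open>Only times \<open>s \<le> t + 1\<close> are considered, which bounds the factor in \<open>envelope_increment\<close>.\<close>
  define \<eta> where "\<eta> = \<epsilon> / (2 * exp (\<alpha> * (t + 1)))"
  have \<eta>: "0 < \<eta>" using \<epsilon> by (simp add: \<eta>_def)
  obtain r where r: "0 < r"
      "\<And>s ts. sorted (s # ts) \<Longrightarrow> last (s # ts) - s < r \<Longrightarrow> close \<eta> (EL (s # ts) u) u"
    using increments_vanish_UC[OF assms u] \<eta> unfolding increments_vanish_def by meson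
  have env_UC: "envelope \<Lambda> S s u \<in> UC" if "0 \<le> s" for s
    using that by (intro admissible_UC[OF envelope_admissible] u)
  have near: "close (\<epsilon> / 2) (envelope \<Lambda> S s' u) (envelope \<Lambda> S s u)"
    if "0 \<le> s" "s \<le> s'" "s' - s < r" "s \<le> t + 1" for s s'
  proof -
    have "close (exp (\<alpha> * s) * \<eta>) (envelope \<Lambda> S s' u) (envelope \<Lambda> S s u)"
      using that r(2) by (intro envelope_increment u) auto
    moreover have "exp (\<alpha> * s) * \<eta> \<le> exp (\<alpha> * (t + 1)) * \<eta>"
      using that \<alpha>_nonneg \<eta> by (intro mult_right_mono) (auto intro: mult_left_mono)
    moreover have "exp (\<alpha> * (t + 1)) * \<eta> = \<epsilon> / 2" by (simp add: \<eta>_def)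
    ultimately show ?thesis by (metis kappa_close_mono)
  qed
  show "\<exists>V. openin (top_of_set {0..}) V \<and> t \<in> V \<and>
      (\<forall>s\<in>V. envelope \<Lambda> S s u \<in> U.mball (envelope \<Lambda> S t u) \<epsilon>)"
  proof (intro exI[of _ "{0..} \<inter> ball t (min r 1)"] conjI ballI)
    show "openin (top_of_set {0..}) ({0..} \<inter> ball t (min r 1))" by (intro openin_open_Int open_ball)
    show "t \<in> {0..} \<inter> ball t (min r 1)" using t0 r by simp
    fix s assume "s \<in> {0..} \<inter> ball t (min r 1)"
    then have s: "0 \<le> s" "\<bar>t - s\<bar> < r" "\<bar>t - s\<bar> < 1" by (auto simp: dist_real_def)
    have "close (\<epsilon> / 2) (envelope \<Lambda> S t u) (envelope \<Lambda> S s u)"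
    proof (cases "s \<le> t")
      case True
      then show ?thesis using s t0 by (intro near) auto
    next
      case False
      then show ?thesis using s t0 by (subst kappa_close_commute) (intro near, auto)
    qed
    then have "kappa_dist \<kappa> (envelope \<Lambda> S t u) (envelope \<Lambda> S s u) \<le> \<epsilon> / 2"
      using env_UC s t0 UC_subset_C by (subst kappa_dist_le_iff) auto
    then show "envelope \<Lambda> S s u \<in> U.mball (envelope \<Lambda> S t u) \<epsilon>"
      using env_UC s t0 \<epsilon> by simp
  qed
qed

end

section \<open>The given semigroups\<close>

lemma (in weight) semigroup_continuous_at:
  assumes S: "feller_semigroup \<kappa> S" and h: "0 \<le> h" and u: "u \<in> UC" and \<epsilon>: "0 < \<epsilon>"
  obtains \<delta> where "0 < \<delta>" "\<And>v. v \<in> UC \<Longrightarrow> close \<delta> u v \<Longrightarrow> close \<epsilon> (S h u) (S h v)"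
proof -
  have "continuous_map U.mtopology U.mtopology (S h)"
    using S h by (simp add: feller_semigroup_def UC_topology_def)
  then have maps: "S h ` UC \<subseteq> UC"
    and cont: "\<forall>u\<in>UC. \<forall>\<epsilon>>0. \<exists>\<delta>>0. \<forall>v. v \<in> UC \<and> kappa_dist \<kappa> u v < \<delta> \<longrightarrow>
      kappa_dist \<kappa> (S h u) (S h v) < \<epsilon>"
    unfolding U.metric_continuous_map[OF U.Metric_space_axioms] by auto
  obtain \<delta> where \<delta>: "0 < \<delta>"
      "\<And>v. v \<in> UC \<Longrightarrow> kappa_dist \<kappa> u v < \<delta> \<Longrightarrow> kappa_dist \<kappa> (S h u) (S h v) < \<epsilon>"
    using cont[rule_format, OF u \<epsilon>] by blast
  show ?thesis
  proof (rule that[of "\<delta> / 2"])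
    fix v assume v: "v \<in> UC" "close (\<delta> / 2) u v"
    then have "kappa_dist \<kappa> u v \<le> \<delta> / 2" using u UC_subset_C by (subst kappa_dist_le_iff) auto
    then have "kappa_dist \<kappa> (S h u) (S h v) < \<epsilon>" using \<delta> v(1) by auto
    then have "kappa_dist \<kappa> (S h u) (S h v) \<le> \<epsilon>" by simp
    moreover have "S h u \<in> C_kappa \<kappa>" "S h v \<in> C_kappa \<kappa>" using maps u v(1) UC_subset_C by auto
    ultimately show "close \<epsilon> (S h u) (S h v)" by (simp add: kappa_dist_le_iff)
  qed (use \<delta> in simp)
qed

text \<open>
  The growth bound, which is given on bounded Lipschitz functions, extends to \<open>UC\<close> by density because
  \<open>S h\<close> is continuous.  Together with linearity it yields the Lipschitz estimate in \<open>admissible\<close>.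
\<close>

lemma (in weight) semigroup_bound:
  assumes S: "feller_semigroup \<kappa> S" and h: "0 \<le> h" and a: "0 < a"
    and Lip: "\<And>u. u \<in> Lip_b \<Longrightarrow> kappa_norm \<kappa> (S h u) \<le> ereal a * kappa_norm \<kappa> u"
    and u: "u \<in> UC" and c: "close c u (\<lambda>_. 0)"
  shows "close (a * c) (S h u) (\<lambda>_. 0)"
  unfolding kappa_close_def
proof
  fix x
  show "\<kappa> x * \<bar>S h u x - 0\<bar> \<le> a * c"
  proof (rule field_le_epsilon)
    fix e :: real assume e: "0 < e"
    define \<epsilon> where "\<epsilon> = e / (a + 1)"
    have "0 < \<epsilon>" "(a + 1) * \<epsilon> = e" using e a by (simp_all add: \<epsilon>_def)
    then have \<epsilon>: "0 < \<epsilon>" "a * \<epsilon> + \<epsilon> = e" by (simp_all add: distrib_right)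
    obtain \<delta> where \<delta>: "0 < \<delta>" "\<And>v. v \<in> UC \<Longrightarrow> close \<delta> u v \<Longrightarrow> close \<epsilon> (S h u) (S h v)"
      using semigroup_continuous_at[OF S h u \<epsilon>(1)] by blast
    have "0 < min \<delta> \<epsilon>" using \<delta>(1) \<epsilon>(1) by simp
    then obtain v where v: "v \<in> Lip_b" "close (min \<delta> \<epsilon>) u v" using u unfolding UC_iff by blast
    have close: "close \<delta> u v" "close \<epsilon> u v" by (rule kappa_close_mono[OF v(2)]; simp)+
    have "close (\<epsilon> + c) v (\<lambda>_. 0)" using close(2) c by (blast intro: close_trans kappa_close_commute[THEN iffD1])
    then have "kappa_norm \<kappa> v \<le> ereal (\<epsilon> + c)" by (simp add: kappa_norm_le_iff_0)
    then have "ereal a * kappa_norm \<kappa> v \<le> ereal a * ereal (\<epsilon> + c)"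
      using a by (intro ereal_mult_left_mono) auto
    then have "kappa_norm \<kappa> (S h v) \<le> ereal (a * (\<epsilon> + c))" using Lip[OF v(1)] by simp
    then have "close (a * (\<epsilon> + c)) (S h v) (\<lambda>_. 0)" by (simp add: kappa_norm_le_iff_0)
    moreover have "close \<epsilon> (S h u) (S h v)"
      using v(1) close(1) Lip_b_subset_UC by (intro \<delta>(2)) auto
    ultimately have "close (\<epsilon> + a * (\<epsilon> + c)) (S h u) (\<lambda>_. 0)" by (blast intro: close_trans)
    moreover have "\<epsilon> + a * (\<epsilon> + c) = a * c + e" using \<epsilon>(2) by (simp add: algebra_simps)
    ultimately show "\<kappa> x * \<bar>S h u x - 0\<bar> \<le> a * c + e" by (simp add: kappa_close_def)
  qed
qed

lemma (in weight) semigroup_affine: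
  assumes "linear_operators \<kappa> S" "0 \<le> h" "S h (\<lambda>_. 1) = (\<lambda>_. 1)" "u \<in> UC"
  shows "S h (\<lambda>x. c + a * u x) = (\<lambda>x. c + a * S h u x)"
proof -
  have "(\<lambda>_. 1) \<in> UC" using const_in_Lip_b Lip_b_subset_UC by blast
  then have "S h (\<lambda>x. c * 1 + a * u x) = (\<lambda>x. c * S h (\<lambda>_. 1) x + a * S h u x)"
    using assms(1)[unfolded linear_operators_def, rule_format, OF assms(2) _ assms(4), of "\<lambda>_. 1" c a]
    by simp
  then show ?thesis using assms(3) by simp
qed

lemma (in weight) semigroup_admissible:
  assumes S: "feller_semigroup \<kappa> S" "linear_operators \<kappa> S" and h: "0 \<le> h"
    and one: "S h (\<lambda>_. 1) = (\<lambda>_. 1)" and ab: "0 < a" "0 < b"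
    and bounds: "\<And>u. u \<in> Lip_b \<Longrightarrow> kappa_norm \<kappa> (S h u) \<le> ereal a * kappa_norm \<kappa> u"
      "\<And>u. u \<in> Lip_b \<Longrightarrow> lip_norm (S h u) \<le> ereal b * lip_norm u"
  shows "admissible a b (S h)"
  unfolding admissible_def
proof (intro conjI ballI allI impI)
  have mono: "S h u x \<le> S h v x" if "u \<in> UC" "v \<in> UC" "\<forall>x. u x \<le> v x" for u v x
    using S(1) h that unfolding feller_semigroup_def by blast
  then show "S h u x \<le> S h v x" if "u \<in> UC" "v \<in> UC" "\<forall>x. u x \<le> v x" for u v x
    using that by blast
  show "close (a * c) (S h u) (S h v)" if uv: "u \<in> UC" "v \<in> UC" "close c u v" for u v c
  proof -
    have lin: "S h (\<lambda>x. 1 * u x + (- 1) * v x) = (\<lambda>x. 1 * S h u x + (- 1) * S h v x)"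
      using S(2) h uv unfolding linear_operators_def by blast
    have "(\<lambda>x. u x - v x) \<in> UC" using UC_linear_combination[OF uv(1,2), of 1 "- 1"] by simp
    then have "close (a * c) (S h (\<lambda>x. u x - v x)) (\<lambda>_. 0)"
      using uv(3) by (intro semigroup_bound S h ab bounds) (auto simp: kappa_close_def)
    then show ?thesis using lin by (simp add: kappa_close_def)
  qed
  fix u :: "'a \<Rightarrow> real" and B K assume u: "\<forall>x. \<bar>u x\<bar> \<le> B" "K-lipschitz_on UNIV u"
  then have u_Lip: "u \<in> Lip_b" using Lip_bI by blast
  have const: "(\<lambda>_. c) \<in> UC" "S h (\<lambda>_. c) = (\<lambda>_. c)" for c
    using subsetD[OF Lip_b_subset_UC const_in_Lip_b] semigroup_affine[OF S(2) h one, of "\<lambda>_. 0" c 0] by simp_all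
  have u_le: "u x \<le> B" "- B \<le> u x" for x using u(1) by (auto simp: abs_le_iff minus_le_iff)
  show "\<bar>S h u x\<bar> \<le> B" for x
    using mono[of u "\<lambda>_. B" x] mono[of "\<lambda>_. - B" u x] u_le const(1) u_Lip Lip_b_subset_UC
    unfolding const(2) by (auto simp: abs_le_iff)
  have "lip_norm (S h u) \<le> ereal b * ereal K"
    using bounds(2)[OF u_Lip] ereal_mult_left_mono[OF lip_norm_le[OF u(2)], of "ereal b"] ab by simp
  then show "(b * K)-lipschitz_on UNIV (S h u)"
    using ab lipschitz_on_nonneg[OF u(2)] by (intro lip_norm_le_imp_lipschitz) auto
qed (use ab in auto)

theorem proposition3p6:
  fixes \<Lambda> :: "'l set"
    and \<kappa> :: "'a::metric_space \<Rightarrow> real"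
    and S :: "'l \<Rightarrow> real \<Rightarrow> ('a \<Rightarrow> real) \<Rightarrow> ('a \<Rightarrow> real)"
  assumes "\<Lambda> \<noteq> {}"
    and "separable_space (euclidean :: 'a topology)"
    and "\<And>x. 0 < \<kappa> x" and "continuous_on UNIV \<kappa>" and "bounded (range \<kappa>)"
    and A1: "\<And>l. l \<in> \<Lambda> \<Longrightarrow> feller_semigroup \<kappa> (S l)"
            "\<And>l. l \<in> \<Lambda> \<Longrightarrow> linear_operators \<kappa> (S l)"
            "\<And>l t. l \<in> \<Lambda> \<Longrightarrow> 0 \<le> t \<Longrightarrow> S l t (\<lambda>_. 1) = (\<lambda>_. 1)"
    and A2: "\<exists>\<alpha> \<beta> :: real. \<forall>u\<in>Lip_b. \<forall>l\<in>\<Lambda>. \<forall>t\<ge>0.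
               kappa_norm \<kappa> (S l t u) \<le> ereal (exp (\<alpha> * t)) * kappa_norm \<kappa> u \<and>
               lip_norm (S l t u) \<le> ereal (exp (\<beta> * t)) * lip_norm u"
    and "\<And>\<delta>::real. 0 < \<delta> \<Longrightarrow> \<exists>\<phi> :: 'a \<Rightarrow> 'a \<Rightarrow> real.
           (\<forall>x. \<phi> x \<in> UC_kappa \<kappa>) \<and>
           (\<forall>x. (\<forall>y. 0 \<le> \<phi> x y \<and> \<phi> x y \<le> 1) \<and> \<phi> x x = 0 \<and> (\<forall>y. \<delta> \<le> dist x y \<longrightarrow> \<phi> x y = 1)) \<and>
           (\<exists>L\<ge>0. \<exists>h\<^sub>0>0. \<forall>h. 0 \<le> h \<and> h < h\<^sub>0 \<longrightarrow> (\<forall>x.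
              (SUP l\<in>\<Lambda>. kappa_norm \<kappa> (\<lambda>y. S l h (\<phi> x) y - \<phi> x y)) \<le> ereal (L * h)))"
  shows "strongly_continuous \<kappa> (envelope \<Lambda> S)"
proof -
  obtain \<alpha> \<beta> where growth: "\<And>u l t. u \<in> Lip_b \<Longrightarrow> l \<in> \<Lambda> \<Longrightarrow> 0 \<le> t \<Longrightarrow>
      kappa_norm \<kappa> (S l t u) \<le> ereal (exp (\<alpha> * t)) * kappa_norm \<kappa> u \<and>
      lip_norm (S l t u) \<le> ereal (exp (\<beta> * t)) * lip_norm u"
    using A2 by blast
  interpret weight \<kappa> using assms(3-5) by unfold_locales
  \<comment> \<open>The constant is raised to \<open>0\<close>, so that the growth factor increases with time.\<close>
  interpret semigroup_family \<kappa> \<Lambda> S "max \<alpha> 0" \<beta>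
  proof
    show "\<Lambda> \<noteq> {}" "0 \<le> max \<alpha> 0" using assms(1) by auto
  next
    fix l and h :: real assume l: "l \<in> \<Lambda>" and h: "0 \<le> h"
    show "admissible (exp (max \<alpha> 0 * h)) (exp (\<beta> * h)) (S l h)"
    proof (rule semigroup_admissible[where S = "S l", OF A1(1)[OF l] A1(2)[OF l] h A1(3)[OF l h]])
      fix u :: "'a \<Rightarrow> real" assume u: "u \<in> Lip_b"
      have "ereal (exp (\<alpha> * h)) * kappa_norm \<kappa> u \<le> ereal (exp (max \<alpha> 0 * h)) * kappa_norm \<kappa> u"
        using h by (intro ereal_mult_right_mono kappa_norm_nonneg) (auto intro: mult_right_mono)
      then show "kappa_norm \<kappa> (S l h u) \<le> ereal (exp (max \<alpha> 0 * h)) * kappa_norm \<kappa> u"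
        using growth[OF u l h] by (blast intro: order_trans)
      show "lip_norm (S l h u) \<le> ereal (exp (\<beta> * h)) * lip_norm u" using growth[OF u l h] by blast
    qed auto
    show "S l h (\<lambda>x. c + a * u x) = (\<lambda>x. c + a * S l h u x)" if "u \<in> UC" for u c a
      using semigroup_affine[OF A1(2)[OF l] h A1(3)[OF l h] that] .
  next
    fix l u and s t :: real assume "l \<in> \<Lambda>" "0 \<le> s" "0 \<le> t" "u \<in> UC"
    then show "S l (s + t) u = S l s (S l t u)" using A1(1) unfolding feller_semigroup_def by blast
  qed
  show ?thesis
  proof (intro envelope_strongly_continuous increments_vanish_Lip_b)
    fix \<delta> :: real assume "0 < \<delta>"
    from assms(10)[OF this] obtain \<phi> L \<rho> where \<phi>: "\<forall>x. \<phi> x \<in> UC"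
        "\<forall>x. (\<forall>y. 0 \<le> \<phi> x y \<and> \<phi> x y \<le> 1) \<and> \<phi> x x = 0 \<and> (\<forall>y. \<delta> \<le> dist x y \<longrightarrow> \<phi> x y = 1)"
      and L: "0 \<le> L" and \<rho>: "0 < \<rho>"
      and sup: "\<forall>h. 0 \<le> h \<and> h < \<rho> \<longrightarrow> (\<forall>x.
        (SUP l\<in>\<Lambda>. kappa_norm \<kappa> (\<lambda>y. S l h (\<phi> x) y - \<phi> x y)) \<le> ereal (L * h))"
      by (elim exE conjE)
    have "close (L * h) (S l h (\<phi> x)) (\<phi> x)" if "0 \<le> h" "h < \<rho>" "l \<in> \<Lambda>" for h x l
      using sup[rule_format, of h x] that by (simp add: SUP_le_iff kappa_norm_le_iff)
    then show "\<exists>\<phi> L \<rho>. (\<forall>x. \<phi> x \<in> UC \<and> (\<forall>y. 0 \<le> \<phi> x y) \<and> \<phi> x x = 0 \<and>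
        (\<forall>y. \<delta> \<le> dist x y \<longrightarrow> \<phi> x y = 1)) \<and> 0 \<le> L \<and> 0 < \<rho> \<and>
        (\<forall>h x. \<forall>l\<in>\<Lambda>. 0 \<le> h \<longrightarrow> h < \<rho> \<longrightarrow> close (L * h) (S l h (\<phi> x)) (\<phi> x))"
      using \<phi> L \<rho> by blast
  qed
qed

end
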